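(* Let $X$ be a compact metric space with metric $d$ and let $G$ be a discrete countable amenable group acting on $X$ by homeomorphisms. Let $K\subseteq X$ be non-empty and compact, and let $\{F_n\}$ be a sequence of finite subsets of $G$ (not necessarily a Følner sequence) satisfying $\lim_{n\to+\infty}\frac{|F_n|}{\log n}=\infty$. Then $$h^B_{top}(K,\{F_n\})=\sup\{\underline h^{loc}_\mu(\{F_n\}):\mu\in M(X),\ \mu(K)=1\},$$ where $M(X)$ is the set of Borel probability measures on $X$, $h^B_{top}(K,\{F_n\})$ is the Bowen topological entropy of $K$ along $\{F_n\}$, and $\underline h^{loc}_\mu(\{F_n\})$ is the (lower) local entropy of $\mu$ along $\{F_n\}$.
   Context: For a finite set $F\subset G$, $x\in X$ and $\epsilon>0$, $B_F(x,\epsilon)=\{y\in X: d(gx,gy)<\epsilon \text{ for all } g\in F\}$. Lower local entropy: for $\mu\in M(X)$, $x\in X$, $\epsilon>0$ put $\underline h^{loc}_\mu(x,\epsilon,\{F_n\})=\liminf_{n\to+\infty}-\frac{1}{|F_n|}\log\mu(B_{F_n}(x,\epsilon))$, $\underline h^{loc}_\mu(x,\{F_n\})=\lim_{\epsilon\to0}\underline h^{loc}_\mu(x,\epsilon,\{F_n\})$, and $\underline h^{loc}_\mu(\{F_n\})=\int_X\underline h^{loc}_\mu(x,\{F_n\})\,d\mu(x)$. Bowen topological entropy: let $\mathcal{U}$ be a finite open cover of $X$. For $n\ge1$ let $\mathcal{W}_{F_n}(\mathcal{U})$ be the collection of families $\mathbf{U}=\{U_g\}_{g\in F_n}$ with $U_g\in\mathcal{U}$;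 for such $\mathbf{U}$ put $m(\mathbf{U})=|F_n|$ and $X(\mathbf{U})=\bigcap_{g\in F_n}g^{-1}U_g=\{x\in X: gx\in U_g \text{ for } g\in F_n\}$. For $Z\subset X$, a set $\Lambda\subset\bigcup_{n\ge1}\mathcal{W}_{F_n}(\mathcal{U})$ covers $Z$ if $\bigcup_{\mathbf{U}\in\Lambda}X(\mathbf{U})\supset Z$. For $s\in\mathbb{R}$ and $N\in\mathbb{N}$ let $$\mathcal{M}(Z,\mathcal{U},N,s,\{F_n\})=\inf_\Lambda\sum_{\mathbf{U}\in\Lambda}\exp(-s\,m(\mathbf{U})),$$ the infimum being over all $\Lambda\subset\bigcup_{j\ge N}\mathcal{W}_{F_j}(\mathcal{U})$ that cover $Z$. Let $\mathcal{M}(Z,\mathcal{U},s,\{F_n\})=\lim_{N\to+\infty}\mathcal{M}(Z,\mathcal{U},N,s,\{F_n\})$ and $$h^B_{top}(\mathcal{U},Z,\{F_n\})=\inf\{s:\mathcal{M}(Z,\mathcal{U},s,\{F_n\})=0\}=\sup\{s:\mathcal{M}(Z,\mathcal{U},s,\{F_n\})=+\infty\}.$$ Finally $h^B_{top}(Z,\{F_n\})=\sup_{\mathcal{U}}h^B_{top}(\mathcal{U},Z,\{F_n\})$, where $\mathcal{U}$ runs over finite open covers of $X$. The paper also uses the following equivalent definition. For $Z\subseteq X$, $s\ge0$, $N\in\mathbb{N}$, $\epsilon>0$ let $\mathcal{M}(Z,N,\epsilon,s,\{F_n\})=\inf\sum_i\exp(-s|F_{n_i}|)$ over all finite or countable families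 $\{B_{F_{n_i}}(x_i,\epsilon)\}$ with $x_i\in X$, $n_i\ge N$ and $\bigcup_iB_{F_{n_i}}(x_i,\epsilon)\supseteq Z$. Let $\mathcal{M}(Z,s,\{F_n\})=\lim_{\epsilon\to0}\lim_{N\to+\infty}\mathcal{M}(Z,N,\epsilon,s,\{F_n\})$. Then $h^B_{top}(Z,\{F_n\})$ is the critical value of $s$ at which $\mathcal{M}(Z,s,\{F_n\})$ jumps from $+\infty$ to $0$. *)

theory Defs
  imports "HOL-Probability.Probability" "HOL-Algebra.Group_Action"
begin

definition folner_sequence :: "('g, 'b) monoid_scheme \<Rightarrow> (nat \<Rightarrow> 'g set) \<Rightarrow> bool" where
  "folner_sequence G S \<longleftrightarrow>
     (\<forall>n. finite (S n) \<and> S n \<noteq> {} \<and> S n \<subseteq> carrier G) \<and>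
     (\<forall>g\<in>carrier G.
        (\<lambda>n. real (card (sym_diff (g <#\<^bsub>G\<^esub> S n) (S n))) / real (card (S n))) \<longlonglongrightarrow> 0)"

definition countable_amenable_group :: "('g, 'b) monoid_scheme \<Rightarrow> bool" where
  "countable_amenable_group G \<longleftrightarrow>
     group G \<and> countable (carrier G) \<and> (\<exists>S. folner_sequence G S)"

text \<open>
  Throughout, \<phi> g x is the action of g on the point x, and the ambient space is the
  whole type of x.
\<close>

definition bowen_ball ::
    "('g \<Rightarrow> 'x::metric_space \<Rightarrow> 'x) \<Rightarrow> 'g set \<Rightarrow> 'x \<Rightarrow> real \<Rightarrow> 'x set" where
  "bowen_ball \<phi> A x \<epsilon> = {y. \<forall>g\<in>A. dist (\<phi> g x) (\<phi> g y) < \<epsilon>}"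

text \<open>
  The value at 0 has to be set by hand, because ln 0 = 0 for the real logarithm.
\<close>

definition neg_log :: "real \<Rightarrow> ereal" where
  "neg_log p = (if p = 0 then \<infinity> else ereal (- ln p))"

definition lower_local_entropy_at_scale ::
    "('g \<Rightarrow> 'x::metric_space \<Rightarrow> 'x) \<Rightarrow> (nat \<Rightarrow> 'g set) \<Rightarrow> 'x measure \<Rightarrow> 'x \<Rightarrow> real \<Rightarrow> ereal" where
  "lower_local_entropy_at_scale \<phi> F \<mu> x \<epsilon> =
     liminf (\<lambda>n. ereal (1 / real (card (F n))) * neg_log (measure \<mu> (bowen_ball \<phi> (F n) x \<epsilon>)))"

text \<open>
  For a Borel probability measure and continuous maps \<phi> g, the value at scale \<epsilon> is
  nonnegative and increases as \<epsilon> decreases to 0, so the limit below exists in [0, \<infinity>].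
  It is a Borel function of x (Bowen balls of finite sets have lower semicontinuous
  measure), hence the nonnegative integral is the ordinary one.
\<close>

definition lower_local_entropy_at ::
    "('g \<Rightarrow> 'x::metric_space \<Rightarrow> 'x) \<Rightarrow> (nat \<Rightarrow> 'g set) \<Rightarrow> 'x measure \<Rightarrow> 'x \<Rightarrow> ereal" where
  "lower_local_entropy_at \<phi> F \<mu> x =
     Lim (at_right 0) (\<lambda>\<epsilon>. lower_local_entropy_at_scale \<phi> F \<mu> x \<epsilon>)"

definition lower_local_entropy ::
    "('g \<Rightarrow> 'x::metric_space \<Rightarrow> 'x) \<Rightarrow> (nat \<Rightarrow> 'g set) \<Rightarrow> 'x measure \<Rightarrow> ereal" where
  "lower_local_entropy \<phi> F \<mu> =
     enn2ereal (\<integral>\<^sup>+ x. e2ennreal (lower_local_entropy_at \<phi> F \<mu> x) \<partial>\<mu>)"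

definition finite_open_cover :: "'x::topological_space set set \<Rightarrow> bool" where
  "finite_open_cover \<U> \<longleftrightarrow> finite \<U> \<and> (\<forall>U\<in>\<U>. open U) \<and> \<Union>\<U> = UNIV"

text \<open>
  A family of members of the cover indexed by a finite set A is a partial function with
  domain A, so that the family determines its index set.
\<close>

definition cover_words :: "'g set \<Rightarrow> 'x set set \<Rightarrow> ('g \<rightharpoonup> 'x set) set" where
  "cover_words A \<U> = {W. dom W = A \<and> ran W \<subseteq> \<U>}"

definition word_length :: "('g \<rightharpoonup> 'x set) \<Rightarrow> nat" where
  "word_length W = card (dom W)"

definition word_set :: "('g \<Rightarrow> 'x \<Rightarrow> 'x) \<Rightarrow> ('g \<rightharpoonup> 'x set) \<Rightarrow> 'x set" where
  "word_set \<phi> W = {x. \<forall>g\<in>dom W. \<phi> g x \<in> the (W g)}"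

definition cover_sum_from ::
    "('g \<Rightarrow> 'x \<Rightarrow> 'x) \<Rightarrow> (nat \<Rightarrow> 'g set) \<Rightarrow> 'x set \<Rightarrow> 'x set set \<Rightarrow> nat \<Rightarrow> real \<Rightarrow> ennreal" where
  "cover_sum_from \<phi> F Z \<U> N s =
     (INF \<Lambda> \<in> {\<Lambda>. \<Lambda> \<subseteq> (\<Union>j\<in>{j. j \<ge> 1 \<and> j \<ge> N}. cover_words (F j) \<U>) \<and> Z \<subseteq> (\<Union>W\<in>\<Lambda>. word_set \<phi> W)}.
        \<Sum>\<^sub>\<infinity>W\<in>\<Lambda>. ennreal (exp (- s * real (word_length W))))"

text \<open>The limit exists because the infimum is monotone in N.\<close>

definition cover_sum ::
    "('g \<Rightarrow> 'x \<Rightarrow> 'x) \<Rightarrow> (nat \<Rightarrow> 'g set) \<Rightarrow> 'x set \<Rightarrow> 'x set set \<Rightarrow> real \<Rightarrow> ennreal" where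
  "cover_sum \<phi> F Z \<U> s = lim (\<lambda>N. cover_sum_from \<phi> F Z \<U> N s)"

text \<open>
  The infimum is taken in the extended reals; it is \<infinity> when no s qualifies.
\<close>

definition bowen_entropy_cover ::
    "('g \<Rightarrow> 'x \<Rightarrow> 'x) \<Rightarrow> (nat \<Rightarrow> 'g set) \<Rightarrow> 'x set \<Rightarrow> 'x set set \<Rightarrow> ereal" where
  "bowen_entropy_cover \<phi> F Z \<U> = (INF s \<in> {s. cover_sum \<phi> F Z \<U> s = 0}. ereal s)"

definition bowen_entropy ::
    "('g \<Rightarrow> 'x::topological_space \<Rightarrow> 'x) \<Rightarrow> (nat \<Rightarrow> 'g set) \<Rightarrow> 'x set \<Rightarrow> ereal" where
  "bowen_entropy \<phi> F Z = (SUP \<U> \<in> {\<U>. finite_open_cover \<U>}. bowen_entropy_cover \<phi> F Z \<U>)"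

definition borel_prob_measures :: "'x::topological_space measure set" where
  "borel_prob_measures = {\<mu>. sets \<mu> = sets borel \<and> prob_space \<mu>}"

end

theory Submission
  imports Defs
begin

text \<open>
  If \<open>s\<close> exceeds the Bowen entropy then \<open>K\<close> has covers of arbitrarily small weight by words of
  diameter below \<open>r\<close>, and a word meeting the set where all late Bowen balls of radius \<open>r\<close> have
  measure at most \<open>exp (- s |F n|)\<close> has itself at most that measure; so this set is null for every
  measure, and local entropies are almost everywhere at most \<open>s\<close>.

  Conversely let \<open>s\<close> be smaller than the entropy for a cover \<open>\<V>\<close>, and let \<open>\<U>\<close> star-refine \<open>\<V>\<close>.
  A weighted cover of \<open>K\<close> by words of \<open>\<U>\<close> can be made unweighted by words of \<open>\<V>\<close>: some level
  \<open>n\<close> carries weight at least \<open>1 / (n (n + 1))\<close> at each point, greedily chosen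
  points of this kind are counted by the weights, and the loss \<open>n (n + 1)\<close> is absorbed by \<open>exp (\<delta> |F n|)\<close>
  because \<open>|F n| / ln n\<close> tends to infinity. So weighted covers have weight bounded below, which is
  what the Hahn-Banach theorem needs for a finitely additive probability on \<open>K\<close> giving every late
  word \<open>W\<close> of \<open>\<U>\<close> mass at most a constant times \<open>exp (- s |W|)\<close>. Since words define open sets,
  the bound survives regularization to a Borel measure, whose local entropy is therefore at least
  \<open>s\<close> everywhere.
\<close>

section \<open>The Hahn-Banach theorem for sublinear functionals\<close>

definition sublinear :: "('v::real_vector \<Rightarrow> real) \<Rightarrow> bool" where
  "sublinear q \<longleftrightarrow> (\<forall>x y. q (x + y) \<le> q x + q y) \<and> (\<forall>c x. 0 \<le> c \<longrightarrow> q (c *\<^sub>R x) = c * q x)"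

lemma sublinear_add: "sublinear q \<Longrightarrow> q (x + y) \<le> q x + q y"
  by (simp add: sublinear_def)

lemma sublinear_scale: "sublinear q \<Longrightarrow> 0 \<le> c \<Longrightarrow> q (c *\<^sub>R x) = c * q x"
  by (simp add: sublinear_def)

lemma sublinear_zero: "sublinear q \<Longrightarrow> q 0 = 0"
  using sublinear_scale[of q 0 0] by simp

lemma sublinear_ge: "sublinear q \<Longrightarrow> - q (- x) \<le> q x"
  using sublinear_add[of q x "- x"] sublinear_zero[of q] by simp

text \<open>The infimum over \<open>t \<ge> 0\<close> of
  \<open>q (x + t *\<^sub>R g) - t * q g\<close> works: \<open>t = 0\<close> gives the first bound
  and \<open>t = 1\<close> the second. If \<open>q\<close> is minimal the second bound reads
  \<open>q x + q g \<le> q (x + g)\<close>.\<close>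

lemma sublinear_below_linear_at:
  assumes q: "sublinear q"
  shows "\<exists>r. sublinear r \<and> (\<forall>x. r x \<le> q x) \<and> (\<forall>x. r x \<le> q (x + g) - q g)"
proof -
  define T where "T x = (\<lambda>t. q (x + t *\<^sub>R g) - t * q g) ` {0..}" for x
  define r where "r x = Inf (T x)" for x
  \<comment> \<open>Writing \<open>t *\<^sub>R g\<close> as
    \<open>(x + t *\<^sub>R g) + (- x)\<close> gives a bound independent of \<open>t\<close>, so the
    infimum is finite.\<close>
  have lower: "- q (- x) \<le> q (x + t *\<^sub>R g) - t * q g" if "0 \<le> t" for x t
    using sublinear_add[OF q, of "x + t *\<^sub>R g" "- x"] sublinear_scale[OF q that, of g] by simp
  have bdd: "bdd_below (T x)" for x
    unfolding T_def by (rule bdd_belowI2[where m = "- q (- x)"]) (use lower in auto)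
  have r_le: "r x \<le> q (x + t *\<^sub>R g) - t * q g" if "0 \<le> t" for x t
    unfolding r_def by (rule cInf_lower[OF _ bdd]) (use that in \<open>auto simp: T_def\<close>)
  have r_ge: "z \<le> r x" if "\<And>t. 0 \<le> t \<Longrightarrow> z \<le> q (x + t *\<^sub>R g) - t * q g" for x z
    unfolding r_def by (rule cInf_greatest) (use that in \<open>auto simp: T_def\<close>)
  have add: "r (x + y) \<le> r x + r y" for x y
  proof -
    \<comment> \<open>Shifts \<open>t\<close> for \<open>x\<close> and \<open>u\<close> for
      \<open>y\<close> combine to the shift \<open>t + u\<close> for \<open>x + y\<close>; the
      infima over \<open>u\<close> and then \<open>t\<close> are taken afterwards.\<close>
    have "r (x + y) - (q (x + t *\<^sub>R g) - t * q g) \<le> q (y + u *\<^sub>R g) - u * q g"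
      if "0 \<le> t" "0 \<le> u" for t u
      using r_le[of "t + u" "x + y"] that sublinear_add[OF q, of "x + t *\<^sub>R g" "y + u *\<^sub>R g"]
      by (simp add: algebra_simps)
    then have "r (x + y) - (q (x + t *\<^sub>R g) - t * q g) \<le> r y" if "0 \<le> t" for t
      using that by (intro r_ge) auto
    then have "r (x + y) - r y \<le> r x"
      by (intro r_ge) (simp add: algebra_simps)
    then show ?thesis by simp
  qed
  \<comment> \<open>One inequality suffices: the other one is this one for \<open>1 / c\<close> and
    \<open>c *\<^sub>R x\<close>.\<close>
  have scale_le: "r (c *\<^sub>R x) \<le> c * r x" if "0 < c" for c x
  proof -
    have "r (c *\<^sub>R x) / c \<le> q (x + t *\<^sub>R g) - t * q g" if "0 \<le> t" for t
    proof -
      have "r (c *\<^sub>R x) \<le> q (c *\<^sub>R x + (c * t) *\<^sub>R g) - (c * t) * q g"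
        using \<open>0 < c\<close> that by (intro r_le) simp
      also have "c *\<^sub>R x + (c * t) *\<^sub>R g = c *\<^sub>R (x + t *\<^sub>R g)"
        by (simp add: scaleR_add_right)
      also have "q (c *\<^sub>R (x + t *\<^sub>R g)) = c * q (x + t *\<^sub>R g)"
        using \<open>0 < c\<close> by (intro sublinear_scale[OF q]) simp
      finally show ?thesis using \<open>0 < c\<close> by (simp add: field_simps)
    qed
    then have "r (c *\<^sub>R x) / c \<le> r x" by (rule r_ge)
    then show ?thesis using \<open>0 < c\<close> by (simp add: field_simps)
  qed
  have r0: "r 0 = 0"
  proof (rule antisym)
    show "r 0 \<le> 0" using r_le[of 0 0] sublinear_zero[OF q] by simp
    show "0 \<le> r 0" by (rule r_ge) (simp add: sublinear_scale[OF q])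
  qed
  have scale: "r (c *\<^sub>R x) = c * r x" if "0 \<le> c" for c x
  proof (cases "c = 0")
    case False
    then have "0 < c" using that by simp
    then show ?thesis
      using scale_le[of c x] scale_le[of "1 / c" "c *\<^sub>R x"] by (simp add: field_simps)
  qed (simp add: r0)
  have "sublinear r" unfolding sublinear_def using add scale by blast
  moreover have "r x \<le> q x" for x using r_le[of 0 x] by simp
  moreover have "r x \<le> q (x + g) - q g" for x using r_le[of 1 x] by simp
  ultimately show ?thesis by blast
qed

text \<open>This supplies the bounds of chains for Zorn's lemma. The pointwise infimum is finite
  because sublinearity and the common upper bound \<open>p\<close> force every member to be at least
  \<open>- p (- x)\<close> at \<open>x\<close>.\<close>

lemma sublinear_Inf_chain:
  fixes C :: "('v::real_vector \<Rightarrow> real) set"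
  assumes "C \<noteq> {}" and sub: "\<And>q. q \<in> C \<Longrightarrow> sublinear q"
    and le: "\<And>q x. q \<in> C \<Longrightarrow> q x \<le> p x"
    and chain: "\<And>q r. q \<in> C \<Longrightarrow> r \<in> C \<Longrightarrow> q \<le> r \<or> r \<le> q"
  shows "\<exists>u. sublinear u \<and> (\<forall>q\<in>C. u \<le> q)"
proof -
  define u where "u x = (INF q\<in>C. q x)" for x
  have bdd: "bdd_below ((\<lambda>q. q x) ` C)" for x
  proof (rule bdd_belowI2[where m = "- p (- x)"])
    fix q assume "q \<in> C"
    then show "- p (- x) \<le> q x"
      using sublinear_ge[OF sub, of q x] le[of q "- x"] by simp
  qed
  have u_le: "u x \<le> q x" if "q \<in> C" for q x
    unfolding u_def using bdd that by (rule cINF_lower)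
  have u_ge: "z \<le> u x" if "\<And>q. q \<in> C \<Longrightarrow> z \<le> q x" for z x
    unfolding u_def using \<open>C \<noteq> {}\<close> that by (rule cINF_greatest)
  have "u (x + y) \<le> u x + u y" for x y
  proof -
    \<comment> \<open>Subadditivity does not pass to infima of arbitrary families: here the smaller
      of \<open>q\<close> and \<open>r\<close> handles both arguments at once.\<close>
    have *: "u (x + y) \<le> q x + r y" if q: "q \<in> C" and r: "r \<in> C" for q r
    proof -
      obtain w where w: "w \<in> C" "w \<le> q" "w \<le> r" using chain[OF q r] q r by auto
      have "u (x + y) \<le> w (x + y)" by (rule u_le[OF w(1)])
      also have "\<dots> \<le> w x + w y" by (rule sublinear_add[OF sub[OF w(1)]])
      also have "\<dots> \<le> q x + r y" using w(2,3) by (intro add_mono) (auto simp: le_fun_def)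
      finally show ?thesis .
    qed
    have "u (x + y) - q x \<le> u y" if q: "q \<in> C" for q
    proof (rule u_ge)
      fix r assume "r \<in> C"
      from *[OF q this] show "u (x + y) - q x \<le> r y" by simp
    qed
    then have "u (x + y) - u y \<le> u x" by (intro u_ge) (simp add: algebra_simps)
    then show ?thesis by simp
  qed
  moreover have "u (c *\<^sub>R x) = c * u x" if "0 \<le> c" for c x
  proof (cases "c = 0")
    case True
    obtain q where q: "q \<in> C" using \<open>C \<noteq> {}\<close> by auto
    have "u 0 = 0"
      using u_le[OF q, of 0] u_ge[of 0 0] by (simp add: sublinear_zero[OF sub] q)
    then show ?thesis using True by simp
  next
    case False
    then have c: "0 < c" using that by simp
    have "u (c *\<^sub>R x) / c \<le> u x"
    proof (rule u_ge)
      fix q assume q: "q \<in> C"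
      show "u (c *\<^sub>R x) / c \<le> q x"
        using u_le[OF q, of "c *\<^sub>R x"] sublinear_scale[OF sub[OF q] that, of x] c
        by (simp add: field_simps)
    qed
    moreover have "c * u x \<le> u (c *\<^sub>R x)"
    proof (rule u_ge)
      fix q assume q: "q \<in> C"
      show "c * u x \<le> q (c *\<^sub>R x)"
        using u_le[OF q, of x] sublinear_scale[OF sub[OF q] that, of x] c by simp
    qed
    ultimately show ?thesis using c by (simp add: field_simps)
  qed
  ultimately have "sublinear u" by (simp add: sublinear_def)
  with u_le show ?thesis by (auto simp: le_fun_def)
qed

text \<open>A minimal sublinear functional is superadditive, since otherwise
  \<open>sublinear_below_linear_at\<close> would give a smaller one.\<close>
lemma Hahn_Banach_sublinear:
  fixes p :: "'v::real_vector \<Rightarrow> real"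
  assumes p: "sublinear p"
  shows "\<exists>l. linear l \<and> (\<forall>x. l x \<le> p x) \<and> l e = p e"
proof -
  \<comment> \<open>Minimizing below \<open>p'\<close> instead of \<open>p\<close> fixes the value
    at \<open>e\<close>: the last bound at \<open>- e\<close> gives
    \<open>p' (- e) \<le> - p e\<close>, hence \<open>p e \<le> l e\<close>.\<close>
  obtain p' where p': "sublinear p'" "\<And>x. p' x \<le> p x" "\<And>x. p' x \<le> p (x + e) - p e"
    using sublinear_below_linear_at[OF p, of e] by blast
  define Q where "Q = {q. sublinear q \<and> q \<le> p'}"
  \<comment> \<open>The order is reversed, so that Zorn's lemma yields a minimal element.\<close>
  have "\<exists>l\<in>Q. \<forall>q\<in>Q. l \<ge> q \<longrightarrow> q = l"
  proof (rule predicate_Zorn)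
    show "partial_order_on Q (relation_of (\<ge>) Q)"
      by (auto simp: partial_order_on_def preorder_on_def refl_on_def trans_def antisym_def
          relation_of_def)
    fix C assume C: "C \<in> Chains (relation_of (\<ge>) Q)"
    show "\<exists>u\<in>Q. \<forall>q\<in>C. q \<ge> u"
    proof (cases "C = {}")
      case True
      then show ?thesis using p' by (auto simp: Q_def)
    next
      case False
      have CQ: "q \<in> Q" if "q \<in> C" for q
        using C that by (auto simp: Chains_def relation_of_def)
      have "\<exists>u. sublinear u \<and> (\<forall>q\<in>C. u \<le> q)"
      proof (rule sublinear_Inf_chain[OF False, where p = p'])
        show "sublinear q" if "q \<in> C" for q using CQ[OF that] by (simp add: Q_def)
        show "q x \<le> p' x" if "q \<in> C" for q x using CQ[OF that] by (simp add: Q_def le_fun_def)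
        show "q \<le> r \<or> r \<le> q" if "q \<in> C" "r \<in> C" for q r
          using C that by (auto simp: Chains_def relation_of_def)
      qed
      then obtain u where u: "sublinear u" "\<And>q. q \<in> C \<Longrightarrow> u \<le> q" by blast
      obtain q where "q \<in> C" using False by auto
      then have "u \<in> Q" using u CQ[of q] by (auto simp: Q_def intro: order_trans)
      with u(2) show ?thesis by blast
    qed
  qed
  then obtain l where l: "sublinear l" "l \<le> p'"
    and min: "\<And>q. sublinear q \<Longrightarrow> q \<le> l \<Longrightarrow> q = l"
    unfolding Q_def by (auto intro: order_trans)
  have superadd: "l x + l g \<le> l (x + g)" for x g
  proof -
    obtain r where r: "sublinear r" "\<And>x. r x \<le> l x" "\<And>x. r x \<le> l (x + g) - l g"
      using sublinear_below_linear_at[OF l(1), of g] by blast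
    have "r = l" using r by (intro min) (auto simp: le_fun_def)
    then show ?thesis using r(3)[of x] by simp
  qed
  have add: "l (x + y) = l x + l y" for x y
    using superadd sublinear_add[OF l(1)] by (rule antisym[rotated])
  have neg: "l (- x) = - l x" for x
    using add[of x "- x"] sublinear_zero[OF l(1)] by simp
  have "linear l"
  proof (rule linearI)
    show "l (c *\<^sub>R x) = c *\<^sub>R l x" for c x
    proof (cases "0 \<le> c")
      case False
      then show ?thesis using sublinear_scale[OF l(1), of "- c" x] neg[of "c *\<^sub>R x"] by simp
    qed (simp add: sublinear_scale[OF l(1)])
  qed (rule add)
  moreover have le: "l x \<le> p x" for x
    using l(2) p'(2)[of x] by (auto simp: le_fun_def intro: order_trans)
  moreover have "p e \<le> l e"
  proof -
    have "l (- e) \<le> p' (- e)" using l(2) by (simp add: le_fun_def)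
    also have "\<dots> \<le> p 0 - p e" using p'(3)[of "- e"] by simp
    finally show ?thesis by (simp add: neg sublinear_zero[OF p])
  qed
  ultimately show ?thesis by (blast intro: antisym)
qed

section \<open>Finitely additive charges with prescribed bounds\<close>

text \<open>Hahn-Banach is applied on a type of class \<open>real_vector\<close>. Bounded continuous
  functions on the discrete space form such a type, and its norm bounds every function by a
  constant.\<close>

definition bounded_indicator :: "'a set \<Rightarrow> 'a discrete \<Rightarrow>\<^sub>C real" where
  "bounded_indicator A = Bcontfun (\<lambda>d. indicator A (of_discrete d))"

lemma apply_bounded_indicator:
  "apply_bcontfun (bounded_indicator A) d = indicator A (of_discrete d)"
  unfolding bounded_indicator_def
proof (subst Bcontfun_inverse)
  show "(\<lambda>d. indicator A (of_discrete d) :: real) \<in> bcontfun"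
  proof (rule bcontfun_normI)
    show "continuous_on UNIV (\<lambda>d. indicator A (of_discrete d) :: real)"
      unfolding continuous_on_open_invariant by (auto intro: open_discrete)
    show "norm (indicator A (of_discrete d) :: real) \<le> 1" for d
      by (simp add: indicator_def)
  qed
qed simp

text \<open>The charge is a Hahn-Banach extension below the cost of dominating a function by
  weighted sums of the sets; bounded functions are continuous ones for the discrete topology.\<close>
lemma finitely_additive_charge_exists:
  fixes S :: "'i \<Rightarrow> 'a set" and a :: "'i \<Rightarrow> real"
  assumes cost: "\<And>J c. finite J \<Longrightarrow> J \<subseteq> I \<Longrightarrow> (\<And>i. 0 \<le> c i) \<Longrightarrow>
      (\<And>x. x \<in> K \<Longrightarrow> 1 \<le> (\<Sum>i\<in>J. c i * indicator (S i) x)) \<Longrightarrow> 1 \<le> (\<Sum>i\<in>J. c i * a i)"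
    and a: "\<And>i. i \<in> I \<Longrightarrow> 0 \<le> a i"
    and cover: "finite J0" "J0 \<subseteq> I" "K \<subseteq> (\<Union>i\<in>J0. S i)"
  shows "\<exists>m :: 'a set \<Rightarrow> real. (\<forall>A. 0 \<le> m A) \<and> m UNIV = 1 \<and>
    (\<forall>A B. A \<inter> B = {} \<longrightarrow> m (A \<union> B) = m A + m B) \<and> m (- K) = 0 \<and>
    (\<forall>i\<in>I. m (S i) \<le> a i)"
proof -
  \<comment> \<open>Domination is asked on \<open>K\<close> only. Functions that are nonpositive on
    \<open>K\<close> therefore have cost at most 0, which makes the charge vanish on
    \<open>- K\<close>.\<close>
  define dom :: "('a discrete \<Rightarrow>\<^sub>C real) \<Rightarrow> 'i set \<Rightarrow> ('i \<Rightarrow> real) \<Rightarrow> bool" where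
    "dom f J c \<longleftrightarrow> finite J \<and> J \<subseteq> I \<and> (\<forall>i. 0 \<le> c i) \<and>
      (\<forall>x\<in>K. apply_bcontfun f (discrete x) \<le> (\<Sum>i\<in>J. c i * indicator (S i) x))" for f J c
  define V where "V f = {v. \<exists>J c. dom f J c \<and> v = (\<Sum>i\<in>J. c i * a i)}" for f
  define p where "p f = Inf (V f)" for f
  have V_nonneg: "0 \<le> v" if "v \<in> V f" for f v
    using that a by (auto simp: V_def dom_def intro!: sum_nonneg mult_nonneg_nonneg)
  have bdd: "bdd_below (V f)" for f
    using V_nonneg by (rule bdd_belowI)
  have ne: "V f \<noteq> {}" for f
  proof -
    \<comment> \<open>The finite cover \<open>J0\<close> with constant coefficient
      \<open>norm f\<close> dominates \<open>f\<close>, so the infimum defining \<open>p f\<close>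
      is over a nonempty set.\<close>
    have "dom f J0 (\<lambda>_. norm f)"
      unfolding dom_def
    proof (intro conjI ballI allI)
      fix x assume "x \<in> K"
      then obtain j where j: "j \<in> J0" "x \<in> S j" using cover by auto
      have "apply_bcontfun f (discrete x) \<le> norm f"
        using norm_bounded[of f "discrete x"] by simp
      also have "\<dots> = norm f * indicator (S j) x" using j by simp
      also have "\<dots> \<le> (\<Sum>i\<in>J0. norm f * indicator (S i) x)"
        using j cover by (intro member_le_sum) auto
      finally show "apply_bcontfun f (discrete x) \<le> (\<Sum>i\<in>J0. norm f * indicator (S i) x)" .
    qed (use cover in auto)
    then show ?thesis by (auto simp: V_def)
  qed
  have p_le: "p f \<le> v" if "v \<in> V f" for f v
    unfolding p_def using that bdd by (rule cInf_lower)
  have p_ge: "z \<le> p f" if "\<And>v. v \<in> V f \<Longrightarrow> z \<le> v" for f z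
    unfolding p_def using ne that by (rule cInf_greatest)
  have V_add: "v + w \<in> V (f + g)" if v: "v \<in> V f" and w: "w \<in> V g" for f g v w
  proof -
    obtain J c where J: "dom f J c" and v: "v = (\<Sum>i\<in>J. c i * a i)" using v by (auto simp: V_def)
    obtain L d where L: "dom g L d" and w: "w = (\<Sum>i\<in>L. d i * a i)" using w by (auto simp: V_def)
    \<comment> \<open>The index sets may overlap, so coefficients are extended by 0 and
      added.\<close>
    define e where "e i = (if i \<in> J then c i else 0) + (if i \<in> L then d i else 0)" for i
    have fin: "finite J" "finite L" using J L by (auto simp: dom_def)
    have e_sum: "(\<Sum>i\<in>J \<union> L. e i * h i) = (\<Sum>i\<in>J. c i * h i) + (\<Sum>i\<in>L. d i * h i)"
      for h :: "'i \<Rightarrow> real"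
    proof -
      have "(\<Sum>i\<in>J \<union> L. e i * h i) = (\<Sum>i\<in>J \<union> L. if i \<in> J then c i * h i else 0) +
          (\<Sum>i\<in>J \<union> L. if i \<in> L then d i * h i else 0)"
        unfolding sum.distrib[symmetric] by (rule sum.cong) (auto simp: e_def algebra_simps)
      also have "(\<Sum>i\<in>J \<union> L. if i \<in> J then c i * h i else 0) = (\<Sum>i\<in>J. c i * h i)"
        using fin by (intro sum.mono_neutral_cong_right) auto
      also have "(\<Sum>i\<in>J \<union> L. if i \<in> L then d i * h i else 0) = (\<Sum>i\<in>L. d i * h i)"
        using fin by (intro sum.mono_neutral_cong_right) auto
      finally show ?thesis .
    qed
    have "dom (f + g) (J \<union> L) e"
      using J L unfolding dom_def e_sum by (auto simp: e_def intro: add_mono)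
    then show ?thesis unfolding V_def v w e_sum[symmetric] by blast
  qed
  have V_scale: "k * v \<in> V (k *\<^sub>R f)" if v: "v \<in> V f" and k: "0 \<le> k" for f v k
  proof -
    obtain J c where J: "dom f J c" and v: "v = (\<Sum>i\<in>J. c i * a i)" using v by (auto simp: V_def)
    have "dom (k *\<^sub>R f) J (\<lambda>i. k * c i)"
      using J k by (auto simp: dom_def mult.assoc sum_distrib_left[symmetric] intro: mult_left_mono)
    moreover have "k * v = (\<Sum>i\<in>J. k * c i * a i)"
      by (simp add: v sum_distrib_left mult.assoc)
    ultimately show ?thesis unfolding V_def by blast
  qed
  have p0: "p f \<le> 0" if "\<And>x. x \<in> K \<Longrightarrow> apply_bcontfun f (discrete x) \<le> 0" for f
    by (rule p_le) (use that in \<open>auto simp: V_def dom_def intro!: exI[of _ "{}"]\<close>)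
  have "sublinear p"
    unfolding sublinear_def
  proof (intro conjI allI impI)
    fix f g
    have "p (f + g) - v \<le> w" if "v \<in> V f" "w \<in> V g" for v w
      using p_le[OF V_add[OF that]] by simp
    then have "p (f + g) - v \<le> p g" if "v \<in> V f" for v using that by (intro p_ge) auto
    then have "p (f + g) - p g \<le> p f" by (intro p_ge) (auto simp: algebra_simps)
    then show "p (f + g) \<le> p f + p g" by simp
  next
    fix k :: real and f assume k: "0 \<le> k"
    have le: "p (k *\<^sub>R f) \<le> k * p f" if k: "0 < k" for k f
    proof -
      have "p (k *\<^sub>R f) / k \<le> p f"
        using p_le[OF V_scale[of _ f k]] k by (intro p_ge) (auto simp: field_simps)
      then show ?thesis using k by (simp add: field_simps)
    qed
    have "p 0 = 0" by (intro antisym p0 p_ge) (auto intro: V_nonneg)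
    then show "p (k *\<^sub>R f) = k * p f"
      using k le[of k f] le[of "1 / k" "k *\<^sub>R f"] by (cases "k = 0") (auto simp: field_simps)
  qed
  then obtain l where l: "linear l" "\<And>f. l f \<le> p f"
    and l1: "l (bounded_indicator UNIV) = p (bounded_indicator UNIV)"
    using Hahn_Banach_sublinear[of p "bounded_indicator UNIV"] by blast
  \<comment> \<open>The hypothesis \<open>cost\<close> says precisely that dominating the constant 1
    costs at least 1.\<close>
  have p1: "1 \<le> p (bounded_indicator UNIV)"
    by (rule p_ge) (auto simp: V_def dom_def apply_bounded_indicator discrete_inverse intro: cost)
  define z where "z = l (bounded_indicator UNIV)"
  have z: "1 \<le> z" using l1 p1 by (simp add: z_def)
  \<comment> \<open>Dividing by \<open>z \<ge> 1\<close> makes the total mass 1 and can only improve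
    the upper bounds \<open>a i\<close>.\<close>
  define m where "m A = l (bounded_indicator A) / z" for A
  have nonneg: "0 \<le> m A" for A
  proof -
    have "l (- bounded_indicator A) \<le> 0"
      using l(2) by (rule order_trans) (auto intro!: p0 simp: apply_bounded_indicator)
    then show ?thesis using z by (simp add: m_def linear_neg[OF l(1)])
  qed
  have add: "m (A \<union> B) = m A + m B" if "A \<inter> B = {}" for A B
  proof -
    have "bounded_indicator (A \<union> B) = bounded_indicator A + bounded_indicator B"
      using that by (intro bcontfun_eqI) (auto simp: apply_bounded_indicator indicator_def)
    then show ?thesis by (simp add: m_def linear_add[OF l(1)] add_divide_distrib)
  qed
  have "l (bounded_indicator (- K)) \<le> 0"
    using l(2) by (rule order_trans) (auto intro!: p0 simp: apply_bounded_indicator discrete_inverse)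
  then have "m (- K) \<le> 0" using z by (simp add: m_def divide_nonpos_pos)
  moreover have "m (S i) \<le> a i" if "i \<in> I" for i
  proof -
    have "dom (bounded_indicator (S i)) {i} (\<lambda>_. 1)"
      using that by (auto simp: dom_def apply_bounded_indicator discrete_inverse)
    then have "p (bounded_indicator (S i)) \<le> a i"
      by (intro p_le) (auto simp: V_def intro!: exI[of _ "{i}"] exI[of _ "\<lambda>_. 1"])
    then have "l (bounded_indicator (S i)) \<le> a i" using l(2) by (rule order_trans[rotated])
    also have "\<dots> \<le> a i * z" using mult_left_mono[OF z a[OF that]] by simp
    finally show ?thesis using z by (simp add: m_def field_simps)
  qed
  moreover have "m UNIV = 1" using z by (simp add: m_def z_def)
  ultimately show ?thesis using nonneg add by (intro exI[of _ m]) (auto intro: antisym)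
qed

section \<open>Regularization of finitely additive charges\<close>

lemma finitely_additive_UN_le:
  fixes m :: "'a set \<Rightarrow> real"
  assumes nonneg: "\<And>A. 0 \<le> m A"
    and add: "\<And>A B. A \<inter> B = {} \<Longrightarrow> m (A \<union> B) = m A + m B"
    and "finite I"
  shows "m (\<Union>i\<in>I. C i) \<le> (\<Sum>i\<in>I. m (C i))"
  using \<open>finite I\<close>
proof induction
  case empty
  show ?case using add[of "{}" "{}"] by simp
next
  case (insert i I)
  have "m (C i \<union> (\<Union>i\<in>I. C i)) = m (C i) + m ((\<Union>i\<in>I. C i) - C i)"
    using add[of "C i" "(\<Union>i\<in>I. C i) - C i"] by simp
  also have "m ((\<Union>i\<in>I. C i) - C i) \<le> m (\<Union>i\<in>I. C i)"
  proof -
    have "((\<Union>i\<in>I. C i) - C i) \<union> (\<Union>i\<in>I. C i) \<inter> C i = (\<Union>i\<in>I. C i)" by blast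
    moreover have "((\<Union>i\<in>I. C i) - C i) \<inter> ((\<Union>i\<in>I. C i) \<inter> C i) = {}" by blast
    ultimately show ?thesis using add nonneg by (metis le_add_same_cancel1)
  qed
  finally show ?case using insert by simp
qed

text \<open>The measure is the metric outer measure generated by the inner content
  \<open>U \<mapsto> sup {m C | C closed, C \<subseteq> U}\<close> of open sets.\<close>
lemma finitely_additive_charge_regularization:
  fixes m :: "'x::metric_space set \<Rightarrow> real"
  assumes compact: "compact (UNIV :: 'x set)"
    and nonneg: "\<And>A. 0 \<le> m A" and one: "m UNIV = 1"
    and add: "\<And>A B. A \<inter> B = {} \<Longrightarrow> m (A \<union> B) = m A + m B"
  shows "\<exists>\<mu>\<in>borel_prob_measures. \<forall>U. open U \<longrightarrow> measure \<mu> U \<le> m U"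
proof -
  define \<tau> where "\<tau> U = (SUP C\<in>{C. closed C \<and> C \<subseteq> U}. ennreal (m C))" for U
  define \<nu> where "\<nu> A = (INF U\<in>{U. open U \<and> A \<subseteq> U}. \<tau> U)" for A
  have mono: "m A \<le> m B" if "A \<subseteq> B" for A B
    using add[of A "B - A"] nonneg[of "B - A"] that by (simp add: Un_absorb1)
  have \<tau>_ge: "ennreal (m C) \<le> \<tau> U" if "closed C" "C \<subseteq> U" for C U
    unfolding \<tau>_def using that by (intro SUP_upper) auto
  have \<tau>_mono: "\<tau> U \<le> \<tau> V" if "U \<subseteq> V" for U V
    unfolding \<tau>_def using that by (intro SUP_subset_mono) auto
  have \<tau>_le: "\<tau> U \<le> ennreal (m U)" for U
    unfolding \<tau>_def by (intro SUP_least ennreal_leI mono) auto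
  have \<nu>_open: "\<nu> U = \<tau> U" if "open U" for U
    unfolding \<nu>_def using that by (intro antisym INF_lower INF_greatest \<tau>_mono) auto
  have \<nu>_mono: "\<nu> A \<le> \<nu> B" if "A \<subseteq> B" for A B
    unfolding \<nu>_def using that by (intro INF_superset_mono) auto
  have m0: "m {} = 0" using add[of "{}" "{}"] by simp
  have \<tau>0: "\<tau> {} = 0" using \<tau>_le[of "{}"] by (simp add: m0)
  have \<nu>0: "\<nu> {} = 0" using \<nu>_open[of "{}"] \<tau>0 by simp
  have \<nu>_approx: "\<exists>U. open U \<and> A \<subseteq> U \<and> \<tau> U \<le> \<nu> A + ennreal e" if "0 < e" for A and e :: real
  proof -
    have "\<nu> A \<le> \<nu> UNIV" by (rule \<nu>_mono) simp
    also have "\<dots> = \<tau> UNIV" by (rule \<nu>_open) simp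
    also have "\<dots> \<le> 1" using \<tau>_le[of UNIV] by (simp add: one)
    finally have "\<nu> A \<noteq> \<infinity>" by (auto simp: top_unique)
    then have "\<nu> A < \<nu> A + ennreal e" using that by (simp add: ennreal_add_left_cancel_less[where b=0, simplified] less_top)
    then show ?thesis unfolding \<nu>_def[of A]
      by (subst (asm) INF_less_iff) (auto intro: less_imp_le)
  qed
  \<comment> \<open>By compactness a closed \<open>C\<close> is covered by finitely many closed
    balls, each inside some \<open>U i\<close>. Grouped by \<open>i\<close> they form closed sets
    \<open>E i\<close> that are admissible for \<open>\<tau> (U i)\<close>, so finite subadditivity
    of \<open>m\<close> suffices.\<close>
  have \<tau>_subadd: "\<tau> (\<Union>i. U i) \<le> (\<Sum>i. \<tau> (U i))" if U: "\<And>i::nat. open (U i)" for U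
    unfolding \<tau>_def[of "\<Union>i. U i"]
  proof (rule SUP_least)
    fix C assume "C \<in> {C. closed C \<and> C \<subseteq> (\<Union>i. U i)}"
    then have C: "closed C" "C \<subseteq> (\<Union>i. U i)" by auto
    have "compact C" using compact_Int_closed[OF compact C(1)] by simp
    have "\<exists>i r. 0 < r \<and> cball x r \<subseteq> U i" if "x \<in> C" for x
      using C(2) that U open_contains_cball by blast
    then obtain i r where ir: "\<And>x. x \<in> C \<Longrightarrow> 0 < r x" "\<And>x. x \<in> C \<Longrightarrow> cball x (r x) \<subseteq> U (i x)"
      by metis
    have "C \<subseteq> (\<Union>x\<in>C. ball x (r x))" using ir(1) by force
    from compactE_image[OF \<open>compact C\<close> _ this]
    obtain D where D: "D \<subseteq> C" "finite D" "C \<subseteq> (\<Union>x\<in>D. ball x (r x))" by auto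
    define E where "E j = (\<Union>x\<in>{x\<in>D. i x = j}. cball x (r x))" for j
    have E: "closed (E j)" "E j \<subseteq> U j" for j
      using D ir(2) by (auto simp: E_def)
    have "C \<subseteq> (\<Union>j\<in>i ` D. E j)" using D(3) ball_subset_cball by (force simp: E_def)
    then have "m C \<le> m (\<Union>j\<in>i ` D. E j)" by (rule mono)
    also have "\<dots> \<le> (\<Sum>j\<in>i ` D. m (E j))"
      using D(2) by (intro finitely_additive_UN_le nonneg add) auto
    finally have "ennreal (m C) \<le> (\<Sum>j\<in>i ` D. ennreal (m (E j)))"
      using nonneg by (simp add: sum_ennreal sum_nonneg ennreal_leI)
    also have "\<dots> \<le> (\<Sum>j\<in>i ` D. \<tau> (U j))" using E by (intro sum_mono \<tau>_ge)
    also have "\<dots> \<le> (\<Sum>j. \<tau> (U j))" using D(2) by (intro sum_le_suminf) auto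
    finally show "ennreal (m C) \<le> (\<Sum>j. \<tau> (U j))" .
  qed
  have outer: "outer_measure_space (Pow UNIV) \<nu>"
    unfolding outer_measure_space_def
  proof (intro conjI)
    show "positive (Pow UNIV) \<nu>" by (simp add: positive_def \<nu>0)
    show "increasing (Pow UNIV) \<nu>" by (simp add: increasing_def \<nu>_mono)
    show "countably_subadditive (Pow UNIV) \<nu>"
      unfolding countably_subadditive_def
    proof (intro allI impI)
      fix A :: "nat \<Rightarrow> 'x set"
      show "\<nu> (\<Union>i. A i) \<le> (\<Sum>i. \<nu> (A i))"
      proof (rule ennreal_le_epsilon)
        fix e :: real assume e: "0 < e"
        have "\<exists>U. open U \<and> A i \<subseteq> U \<and> \<tau> U \<le> \<nu> (A i) + ennreal (e * (1/2) ^ Suc i)" for i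
          using e by (intro \<nu>_approx) simp
        then obtain U where U: "\<And>i. open (U i)" "\<And>i. A i \<subseteq> U i"
          "\<And>i. \<tau> (U i) \<le> \<nu> (A i) + ennreal (e * (1/2) ^ Suc i)" by metis
        have "\<nu> (\<Union>i. A i) \<le> \<nu> (\<Union>i. U i)" using U(2) by (intro \<nu>_mono) auto
        also have "\<dots> = \<tau> (\<Union>i. U i)" using U(1) by (intro \<nu>_open) auto
        also have "\<dots> \<le> (\<Sum>i. \<tau> (U i))" using U(1) by (rule \<tau>_subadd)
        also have "\<dots> \<le> (\<Sum>i. \<nu> (A i) + ennreal (e * (1/2) ^ Suc i))"
          using U(3) by (intro suminf_le) auto
        also have "\<dots> = (\<Sum>i. \<nu> (A i)) + (\<Sum>i. ennreal (e * (1/2) ^ Suc i))"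
          by (rule suminf_add[symmetric]) auto
        also have "(\<Sum>i. ennreal (e * (1/2) ^ Suc i)) = ennreal (e * 1)"
          using e sums_mult[OF power_half_series, of e] by (intro suminf_ennreal_eq) auto
        finally show "\<nu> (\<Union>i. A i) \<le> (\<Sum>i. \<nu> (A i)) + ennreal e" by simp
      qed
    qed
  qed
  \<comment> \<open>Caratheodory's condition is tested on a nearly optimal open \<open>V\<close>
    containing \<open>A\<close>: a closed \<open>C\<close> inside \<open>U \<inter> V\<close> and
    then a closed \<open>D\<close> inside \<open>V - C\<close> are disjoint, so their masses add up
    to at most \<open>\<tau> V\<close>.\<close>
  have meas: "U \<in> lambda_system UNIV (Pow UNIV) \<nu>" if U: "open U" for U
    unfolding lambda_system_def
  proof (intro CollectI conjI ballI)
    fix A :: "'x set"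
    have "\<nu> (U \<inter> A) + \<nu> (- U \<inter> A) \<le> \<nu> A"
    proof (rule ennreal_le_epsilon)
      fix e :: real assume e: "0 < e"
      then obtain V where V: "open V" "A \<subseteq> V" "\<tau> V \<le> \<nu> A + ennreal e" using \<nu>_approx by blast
      have VU: "open (U \<inter> V)" using U V by auto
      have "\<nu> (U \<inter> A) + \<nu> (- U \<inter> A) \<le> \<tau> (U \<inter> V) + \<nu> (- U \<inter> A)"
        using \<nu>_mono[of "U \<inter> A" "U \<inter> V"] V(2) \<nu>_open[OF VU] by (intro add_right_mono) auto
      also have "\<dots> = (SUP C\<in>{C. closed C \<and> C \<subseteq> U \<inter> V}. ennreal (m C) + \<nu> (- U \<inter> A))"
        unfolding \<tau>_def by (rule ennreal_SUP_add_left[symmetric]) auto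
      also have "\<dots> \<le> \<tau> V"
      proof (rule SUP_least)
        fix C assume "C \<in> {C. closed C \<and> C \<subseteq> U \<inter> V}"
        then have C: "closed C" "C \<subseteq> U" "C \<subseteq> V" by auto
        have op: "open (V - C)" using V(1) C(1) by (rule open_Diff)
        have "ennreal (m C) + \<nu> (- U \<inter> A) \<le> ennreal (m C) + \<tau> (V - C)"
          using \<nu>_mono[of "- U \<inter> A" "V - C"] V(2) C(2) \<nu>_open[OF op] by (intro add_left_mono) auto
        also have "\<dots> = (SUP D\<in>{D. closed D \<and> D \<subseteq> V - C}. ennreal (m C) + ennreal (m D))"
          unfolding \<tau>_def by (rule ennreal_SUP_add_right) auto
        also have "\<dots> \<le> \<tau> V"
        proof (rule SUP_least)
          fix D assume "D \<in> {D. closed D \<and> D \<subseteq> V - C}"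
          then have D: "closed D" "D \<subseteq> V" "C \<inter> D = {}" by auto
          then have "ennreal (m C) + ennreal (m D) = ennreal (m (C \<union> D))"
            using nonneg by (simp add: add)
          also have "\<dots> \<le> \<tau> V" using C D by (intro \<tau>_ge) auto
          finally show "ennreal (m C) + ennreal (m D) \<le> \<tau> V" .
        qed
        finally show "ennreal (m C) + \<nu> (- U \<inter> A) \<le> \<tau> V" .
      qed
      also note V(3)
      finally show "\<nu> (U \<inter> A) + \<nu> (- U \<inter> A) \<le> \<nu> A + ennreal e" .
    qed
    moreover have "\<nu> A \<le> \<nu> (U \<inter> A) + \<nu> (- U \<inter> A)"
    proof -
      have "subadditive (Pow UNIV) \<nu>"
        using outer ring_of_sets.countably_subadditive_subadditive[OF ring_of_sets_Pow]
        unfolding outer_measure_space_def by blast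
      from subadditiveD[OF this, of "U \<inter> A" "- U \<inter> A"]
      have "\<nu> (U \<inter> A \<union> - U \<inter> A) \<le> \<nu> (U \<inter> A) + \<nu> (- U \<inter> A)" by auto
      also have "U \<inter> A \<union> - U \<inter> A = A" by auto
      finally show ?thesis .
    qed
    ultimately show "\<nu> (U \<inter> A) + \<nu> ((UNIV - U) \<inter> A) = \<nu> A"
      by (simp add: Compl_eq_Diff_UNIV antisym)
  qed simp
  interpret sigma_algebra "UNIV :: 'x set" "Pow UNIV" by (rule sigma_algebra_Pow)
  have L: "measure_space UNIV (lambda_system UNIV (Pow UNIV) \<nu>) \<nu>"
    using outer by (rule caratheodory_lemma)
  have "sigma_sets UNIV {U. open U} \<subseteq> lambda_system UNIV (Pow UNIV) \<nu>"
    using L meas by (intro sigma_algebra.sigma_sets_subset) (auto simp: measure_space_def)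
  then have sub: "sets borel \<subseteq> lambda_system UNIV (Pow UNIV) \<nu>"
    by (simp add: borel_def)
  have "measure_space UNIV (sets borel) \<nu>"
    using measure_down[OF L _ sub] sets.sigma_algebra_axioms[of "borel :: 'x measure"] by simp
  then have ms: "measure_space UNIV (sigma_sets UNIV (sets (borel :: 'x measure))) \<nu>"
    using sets.sigma_sets_eq[of "borel :: 'x measure"] by simp
  define \<mu> where "\<mu> = measure_of UNIV (sets (borel :: 'x measure)) \<nu>"
  have sets: "sets \<mu> = sets borel"
    using sets.sigma_sets_eq[of "borel :: 'x measure"] by (simp add: \<mu>_def)
  have em: "emeasure \<mu> A = \<nu> A" if "A \<in> sets borel" for A
    using ms that unfolding \<mu>_def measure_space_def by (intro emeasure_measure_of_sigma) (auto simp: sets.sigma_sets_eq[of "borel :: 'x measure", simplified])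
  \<comment> \<open>The whole space is closed as well as open, so the inner content loses no mass
    there.\<close>
  have "emeasure \<mu> UNIV = 1"
    using em[of UNIV] \<nu>_open[of UNIV] \<tau>_le[of UNIV] \<tau>_ge[of UNIV UNIV] one by (auto intro: antisym)
  then have "prob_space \<mu>"
    using sets_eq_imp_space_eq[OF sets] by (intro prob_spaceI) simp
  moreover have "measure \<mu> U \<le> m U" if "open U" for U
    using em[of U] \<nu>_open[OF that] \<tau>_le[of U] nonneg[of U] that
    by (simp add: measure_def enn2real_leI)
  ultimately show ?thesis using sets by (intro bexI[of _ \<mu>]) (auto simp: borel_prob_measures_def)
qed

section \<open>Covers and words\<close>

text \<open>Choose a point \<open>x\<close> of \<open>Z\<close> and delete all sets through it.
  Their total weight is at least \<open>t\<close>, and points outside them keep their full weight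
  under the remaining sets. So every chosen point uses up its own share \<open>t\<close> of
  \<open>sum c J\<close>.\<close>

lemma greedy_cover:
  fixes S :: "'i \<Rightarrow> 'a set" and c :: "'i \<Rightarrow> real"
  assumes "finite J" and "\<And>i. 0 \<le> c i" and "0 < t"
    and "\<And>x. x \<in> Z \<Longrightarrow> t \<le> (\<Sum>i\<in>J. c i * indicator (S i) x)"
  shows "\<exists>E. finite E \<and> Z \<subseteq> (\<Union>x\<in>E. \<Union>i\<in>{i\<in>J. x \<in> S i}. S i) \<and> real (card E) * t \<le> sum c J"
  using assms(1,4)
proof (induction J arbitrary: Z rule: finite_psubset_induct)
  case (psubset J)
  show ?case
  proof (cases "Z = {}")
    case True
    then show ?thesis using assms(2) by (auto intro!: exI[of _ "{}"] sum_nonneg)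
  next
    case False
    then obtain x where x: "x \<in> Z" by auto
    define Jx where "Jx = {i\<in>J. x \<in> S i}"
    have fin: "finite J" by (rule psubset)
    have "(\<Sum>i\<in>J. c i * indicator (S i) x) = sum c Jx"
      unfolding Jx_def sum.inter_filter[OF fin] by (intro sum.cong) (auto simp: indicator_def)
    then have t: "t \<le> sum c Jx" using psubset.prems[OF x] by simp
    then have "Jx \<noteq> {}" using \<open>0 < t\<close> by auto
    then have "J - Jx \<subset> J" by (auto simp: Jx_def)
    moreover have "t \<le> (\<Sum>i\<in>J - Jx. c i * indicator (S i) y)" if y: "y \<in> Z - (\<Union>i\<in>Jx. S i)" for y
    proof -
      have "(\<Sum>i\<in>J - Jx. c i * indicator (S i) y) = (\<Sum>i\<in>J. c i * indicator (S i) y)"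
        using fin y by (intro sum.mono_neutral_left) auto
      then show ?thesis using psubset.prems y by simp
    qed
    ultimately obtain E where E: "finite E" 
      "Z - (\<Union>i\<in>Jx. S i) \<subseteq> (\<Union>x\<in>E. \<Union>i\<in>{i\<in>J - Jx. x \<in> S i}. S i)"
      "real (card E) * t \<le> sum c (J - Jx)"
      using psubset.IH[of "J - Jx" "Z - (\<Union>i\<in>Jx. S i)"] by blast
    have "real (card (insert x E)) * t \<le> (1 + real (card E)) * t"
      using \<open>0 < t\<close> E(1) by (intro mult_right_mono) (auto simp: card_insert_if)
    also have "\<dots> \<le> sum c Jx + sum c (J - Jx)"
      using t E(3) by (simp add: algebra_simps)
    also have "\<dots> = sum c J"
      using fin by (subst sum.subset_diff[of Jx J]) (auto simp: Jx_def)
    finally have "real (card (insert x E)) * t \<le> sum c J" .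
    moreover have "Z \<subseteq> (\<Union>x\<in>insert x E. \<Union>i\<in>{i\<in>J. x \<in> S i}. S i)"
      using E(2) by (fastforce simp: Jx_def)
    ultimately show ?thesis using E(1) by blast
  qed
qed

text \<open>The sum telescopes; strictness is what contradicts a total weight of at least 1 in the
  pigeonhole argument over levels.\<close>

lemma sum_inverse_consecutive_less_1:
  assumes "finite T" "\<And>n. n \<in> T \<Longrightarrow> 1 \<le> n"
  shows "(\<Sum>n\<in>T. 1 / (real n * real (n + 1))) < 1"
proof -
  have "(\<Sum>n\<in>T. 1 / (real n * real (n + 1))) \<le> (\<Sum>n=1..Max (insert 1 T). 1 / (real n * real (n + 1)))"
    using assms by (intro sum_mono2) auto
  also have "(\<Sum>n=1..k. 1 / (real n * real (n + 1))) = 1 - 1 / real (k + 1)" for k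
  proof (induction k)
    case (Suc k)
    have "1 / (real (Suc k) * real (Suc k + 1)) = 1 / real (k + 1) - 1 / real (Suc k + 1)"
      by (simp add: field_simps)
    with Suc show ?case by simp
  qed simp
  finally show ?thesis by (simp add: order.strict_trans1)
qed

section \<open>Words over finite open covers, and Lebesgue numbers\<close>

lemma finite_cover_words:
  assumes "finite A" "finite \<U>"
  shows "finite (cover_words A \<U>)"
  unfolding cover_words_def using finite_set_of_finite_maps[OF assms] .

lemma word_length_cover_words: "W \<in> cover_words A \<U> \<Longrightarrow> word_length W = card A"
  by (simp add: cover_words_def word_length_def)

lemma cover_words_the: "W \<in> cover_words A \<U> \<Longrightarrow> g \<in> A \<Longrightarrow> the (W g) \<in> \<U>"
  by (auto simp: cover_words_def ran_def)

lemma cover_word_through: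
  assumes "finite_open_cover \<U>"
  shows "\<exists>W\<in>cover_words A \<U>. x \<in> word_set \<phi> W"
proof -
  have "\<exists>U\<in>\<U>. \<phi> g x \<in> U" for g using assms by (auto simp: finite_open_cover_def)
  then obtain u where u: "\<And>g. u g \<in> \<U>" "\<And>g. \<phi> g x \<in> u g" by metis
  show ?thesis
    by (rule bexI[of _ "\<lambda>g. if g \<in> A then Some (u g) else None"])
      (use u in \<open>auto simp: cover_words_def word_set_def dom_def ran_def split: if_splits\<close>)
qed

lemma finite_small_open_cover:
  assumes "compact (UNIV :: 'x::metric_space set)" "0 < r"
  obtains \<U> :: "'x::metric_space set set" where "finite_open_cover \<U>"
    "\<And>U x y. U \<in> \<U> \<Longrightarrow> x \<in> U \<Longrightarrow> y \<in> U \<Longrightarrow> dist x y < r"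
proof -
  have "UNIV \<subseteq> (\<Union>x::'x\<in>UNIV. ball x (r / 2))" using \<open>0 < r\<close> by auto
  from compactE_image[OF assms(1) _ this]
  obtain D where D: "finite D" "UNIV \<subseteq> (\<Union>x::'x\<in>D. ball x (r / 2))" by auto
  show thesis
  proof (rule that[of "(\<lambda>x. ball x (r / 2)) ` D"])
    show "finite_open_cover ((\<lambda>x. ball x (r / 2)) ` D)"
      using D by (auto simp: finite_open_cover_def)
    show "dist x y < r" if "U \<in> (\<lambda>x. ball x (r / 2)) ` D" "x \<in> U" "y \<in> U" for U x y
      using that by (auto intro: dist_triangle_half_r)
  qed
qed

lemma Lebesgue_number_finite_open_cover:
  assumes compact: "compact (UNIV :: 'x::metric_space set)" and \<V>: "finite_open_cover \<V>"
  shows "\<exists>r>0. \<forall>x::'x. \<exists>V\<in>\<V>. ball x r \<subseteq> V"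
proof -
  have cover: "UNIV \<subseteq> \<Union>\<V>" and op: "V \<in> \<V> \<Longrightarrow> open V" for V
    using \<V> by (auto simp: finite_open_cover_def)
  show ?thesis by (rule Heine_Borel_lemma[OF compact cover op]) auto
qed

section \<open>Cover sums and their critical exponent\<close>

lemma mono_cover_sum_from: "mono (\<lambda>N. cover_sum_from \<phi> F Z \<U> N s)"
  unfolding cover_sum_from_def
  by (rule monoI, rule INF_superset_mono) fastforce+

lemma cover_sum_eq_SUP: "cover_sum \<phi> F Z \<U> s = (SUP N. cover_sum_from \<phi> F Z \<U> N s)"
  unfolding cover_sum_def using LIMSEQ_SUP[OF mono_cover_sum_from] by (rule limI)

lemma cover_sum_from_antimono:
  assumes "s \<le> s'"
  shows "cover_sum_from \<phi> F Z \<U> N s' \<le> cover_sum_from \<phi> F Z \<U> N s"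
  unfolding cover_sum_from_def
proof (rule INF_mono)
  fix \<Lambda> assume "\<Lambda> \<in> {\<Lambda>. \<Lambda> \<subseteq> (\<Union>j\<in>{j. j \<ge> 1 \<and> j \<ge> N}. cover_words (F j) \<U>) \<and> Z \<subseteq> (\<Union>W\<in>\<Lambda>. word_set \<phi> W)}"
  moreover have "(\<Sum>\<^sub>\<infinity>W\<in>\<Lambda>. ennreal (exp (- s' * real (word_length W))))
      \<le> (\<Sum>\<^sub>\<infinity>W\<in>\<Lambda>. ennreal (exp (- s * real (word_length W))))"
    using assms by (intro infsum_mono nonneg_summable_on_complete ennreal_leI) (auto intro!: mult_right_mono)
  ultimately show "\<exists>\<Lambda>'\<in>{\<Lambda>. \<Lambda> \<subseteq> (\<Union>j\<in>{j. j \<ge> 1 \<and> j \<ge> N}. cover_words (F j) \<U>) \<and> Z \<subseteq> (\<Union>W\<in>\<Lambda>. word_set \<phi> W)}.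
      (\<Sum>\<^sub>\<infinity>W\<in>\<Lambda>'. ennreal (exp (- s' * real (word_length W))))
      \<le> (\<Sum>\<^sub>\<infinity>W\<in>\<Lambda>. ennreal (exp (- s * real (word_length W))))" by blast
qed

text \<open>The infimum only provides some smaller exponent with vanishing limit. Antimonotonicity
  carries this to \<open>s\<close>, and the limit in \<open>N\<close> is a supremum, so every single
  \<open>N\<close> gives 0.\<close>

lemma cover_sum_from_eq_0:
  assumes "bowen_entropy_cover \<phi> F Z \<U> < ereal s"
  shows "cover_sum_from \<phi> F Z \<U> N s = 0"
proof -
  obtain s' where s': "cover_sum \<phi> F Z \<U> s' = 0" "s' < s"
    using assms unfolding bowen_entropy_cover_def INF_less_iff by auto
  have "cover_sum_from \<phi> F Z \<U> N s \<le> cover_sum_from \<phi> F Z \<U> N s'"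
    using s'(2) by (intro cover_sum_from_antimono) simp
  also have "\<dots> \<le> cover_sum \<phi> F Z \<U> s'" unfolding cover_sum_eq_SUP by (rule SUP_upper) simp
  finally show ?thesis using s'(1) by simp
qed

lemma cover_sum_from_nonzero:
  assumes "ereal s < bowen_entropy_cover \<phi> F Z \<U>"
  shows "\<exists>N. cover_sum_from \<phi> F Z \<U> N s \<noteq> 0"
proof (rule ccontr)
  assume "\<not> ?thesis"
  then have "cover_sum \<phi> F Z \<U> s = 0" unfolding cover_sum_eq_SUP by simp
  then have "bowen_entropy_cover \<phi> F Z \<U> \<le> ereal s"
    unfolding bowen_entropy_cover_def by (intro INF_lower) simp
  with assms show False by simp
qed

text \<open>For negative \<open>s\<close> every word has weight at least 1.\<close>
lemma bowen_entropy_nonneg: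
  assumes "Z \<noteq> {}"
  shows "0 \<le> bowen_entropy \<phi> F Z"
proof -
  have "0 \<le> s" if "cover_sum \<phi> F Z {UNIV} s = 0" for s
  proof (rule ccontr)
    assume "\<not> 0 \<le> s"
    have "1 \<le> cover_sum_from \<phi> F Z {UNIV} 0 s"
      unfolding cover_sum_from_def
    proof (rule INF_greatest)
      fix \<Lambda> assume "\<Lambda> \<in> {\<Lambda>. \<Lambda> \<subseteq> (\<Union>j\<in>{j. j \<ge> 1 \<and> j \<ge> 0}. cover_words (F j) {UNIV}) \<and> Z \<subseteq> (\<Union>W\<in>\<Lambda>. word_set \<phi> W)}"
      then obtain W where W: "W \<in> \<Lambda>" using assms by auto
      have "(1::ennreal) \<le> ennreal (exp (- s * real (word_length W)))"
        using \<open>\<not> 0 \<le> s\<close> by (auto simp flip: ennreal_1 intro!: ennreal_leI mult_nonpos_nonneg)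
      also have "\<dots> = (\<Sum>\<^sub>\<infinity>W\<in>{W}. ennreal (exp (- s * real (word_length W))))" by simp
      also have "\<dots> \<le> (\<Sum>\<^sub>\<infinity>W\<in>\<Lambda>. ennreal (exp (- s * real (word_length W))))"
        using W by (intro infsum_mono_neutral nonneg_summable_on_complete) auto
      finally show "1 \<le> (\<Sum>\<^sub>\<infinity>W\<in>\<Lambda>. ennreal (exp (- s * real (word_length W))))" .
    qed
    also have "\<dots> \<le> cover_sum \<phi> F Z {UNIV} s" unfolding cover_sum_eq_SUP by (rule SUP_upper) simp
    finally show False using that by simp
  qed
  then have "0 \<le> bowen_entropy_cover \<phi> F Z {UNIV}"
    unfolding bowen_entropy_cover_def by (intro INF_greatest) auto
  also have "\<dots> \<le> bowen_entropy \<phi> F Z"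
    unfolding bowen_entropy_def by (intro SUP_upper) (auto simp: finite_open_cover_def)
  finally show ?thesis .
qed

text \<open>The null set is the intersection of the enclosing sets, so an exceptional set
  \<open>A\<close> can be treated without checking that it is Borel.\<close>

lemma AE_not_in_of_small_cover:
  assumes "\<And>e::real. 0 < e \<Longrightarrow> \<exists>U\<in>sets M. A \<subseteq> U \<and> emeasure M U \<le> ennreal e"
  shows "AE x in M. x \<notin> A"
proof -
  have "\<exists>U\<in>sets M. A \<subseteq> U \<and> emeasure M U \<le> ennreal (1 / real (Suc i))" for i
    using assms by simp
  then obtain U where U: "\<And>i. U i \<in> sets M" "\<And>i. A \<subseteq> U i"
    "\<And>i. emeasure M (U i) \<le> ennreal (1 / real (Suc i))" by metis
  show ?thesis
  proof (rule AE_I)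
    show "{x \<in> space M. \<not> x \<notin> A} \<subseteq> (\<Inter>i. U i)" using U(2) by auto
    show sets: "(\<Inter>i. U i) \<in> sets M" using U(1) by auto
    have "emeasure M (\<Inter>i. U i) \<le> 0"
    proof (rule ennreal_le_epsilon)
      fix e :: real assume "0 < e"
      then obtain i where i: "1 / real (Suc i) < e" using nat_approx_posE by metis
      have "emeasure M (\<Inter>i. U i) \<le> emeasure M (U i)" using U(1) by (intro emeasure_mono) auto
      also have "\<dots> \<le> ennreal (1 / real (Suc i))" by (rule U(3))
      also have "\<dots> \<le> 0 + ennreal e" using i by (simp add: ennreal_leI)
      finally show "emeasure M (\<Inter>i. U i) \<le> 0 + ennreal e" .
    qed
    then show "emeasure M (\<Inter>i. U i) = 0" by simp
  qed
qed

lemma neg_log_antimono: "0 \<le> p \<Longrightarrow> p \<le> q \<Longrightarrow> neg_log q \<le> neg_log p"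
  by (auto simp: neg_log_def)

lemma le_neg_log: "0 \<le> p \<Longrightarrow> 0 < q \<Longrightarrow> p \<le> q \<Longrightarrow> ereal (- ln q) \<le> neg_log p"
  using neg_log_antimono[of p q] by (simp add: neg_log_def)

section \<open>Comparison of Bowen balls with words\<close>

lemma bowen_ball_mono: "\<epsilon> \<le> \<epsilon>' \<Longrightarrow> bowen_ball \<phi> A x \<epsilon> \<subseteq> bowen_ball \<phi> A x \<epsilon>'"
  by (auto simp: bowen_ball_def)

lemma word_set_subset_bowen_ball:
  assumes W: "W \<in> cover_words A \<U>" "x \<in> word_set \<phi> W"
    and small: "\<And>U x y. U \<in> \<U> \<Longrightarrow> x \<in> U \<Longrightarrow> y \<in> U \<Longrightarrow> dist x y < r"
  shows "word_set \<phi> W \<subseteq> bowen_ball \<phi> A x r"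
proof -
  have "dist (\<phi> g x) (\<phi> g y) < r" if "y \<in> word_set \<phi> W" "g \<in> A" for y g
    using W that cover_words_the[OF W(1) that(2)]
    by (intro small[of "the (W g)"]) (auto simp: word_set_def cover_words_def)
  then show ?thesis by (auto simp: bowen_ball_def)
qed

text \<open>Here \<open>r\<close> is a Lebesgue number: the member chosen around each
  \<open>\<phi> g x\<close> contains its whole ball. This turns measure bounds for words into bounds
  for Bowen balls.\<close>

lemma bowen_ball_subset_word_set:
  assumes "\<And>x. \<exists>U\<in>\<U>. ball x r \<subseteq> U"
  shows "\<exists>W\<in>cover_words A \<U>. bowen_ball \<phi> A x r \<subseteq> word_set \<phi> W"
proof -
  obtain u where u: "\<And>x. u x \<in> \<U>" "\<And>x. ball x r \<subseteq> u x" using assms by metis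
  show ?thesis
  proof (rule bexI)
    let ?W = "\<lambda>g. if g \<in> A then Some (u (\<phi> g x)) else None"
    show "?W \<in> cover_words A \<U>"
      using u(1) by (auto simp: cover_words_def dom_def ran_def split: if_splits)
    show "bowen_ball \<phi> A x r \<subseteq> word_set \<phi> ?W"
    proof
      fix y assume "y \<in> bowen_ball \<phi> A x r"
      then have "\<phi> g y \<in> u (\<phi> g x)" if "g \<in> A" for g
        using that u(2)[of "\<phi> g x"] by (auto simp: bowen_ball_def)
      then show "y \<in> word_set \<phi> ?W" by (simp add: word_set_def dom_def)
    qed
  qed
qed

text \<open>The greedy selection covers by stars, that is, by all words of one level through a
  chosen point. Such a star is in general no word of \<open>\<U>\<close>, but it lies in a single
  word of \<open>\<V>\<close>; this is why two covers occur.\<close>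

lemma cover_sum_from_le_weighted:
  assumes star: "\<And>z. \<exists>V\<in>\<V>. \<forall>U\<in>\<U>. z \<in> U \<longrightarrow> U \<subseteq> V"
    and growth: "\<And>n. 1 \<le> n \<Longrightarrow> N \<le> n \<Longrightarrow> ln (real n * real (n + 1)) \<le> \<delta> * real (card (F n))"
    and J: "finite J" "J \<subseteq> (\<Union>j\<in>{j. j \<ge> 1 \<and> j \<ge> N}. cover_words (F j) \<U>)"
    and c: "\<And>W. 0 \<le> c W"
    and ge1: "\<And>x. x \<in> K \<Longrightarrow> 1 \<le> (\<Sum>W\<in>J. c W * indicator (word_set \<phi> W) x)"
  shows "cover_sum_from \<phi> F K \<V> N (s + \<delta>) \<le> ennreal (\<Sum>W\<in>J. c W * exp (- s * real (word_length W)))"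
proof -
  have "\<exists>k. 1 \<le> k \<and> N \<le> k \<and> W \<in> cover_words (F k) \<U>" if "W \<in> J" for W
    using J(2) that by auto
  \<comment> \<open>A word determines its index set but not its level, as \<open>F\<close> may
    repeat values; one admissible level is fixed for each word.\<close>
  then obtain n where n: "\<And>W. W \<in> J \<Longrightarrow> 1 \<le> n W \<and> N \<le> n W \<and> W \<in> cover_words (F (n W)) \<U>"
    by metis
  define Jn where "Jn k = {W\<in>J. n W = k}" for k
  define t where "t k = 1 / (real k * real (k + 1))" for k :: nat
  define Z where "Z k = {x\<in>K. t k \<le> (\<Sum>W\<in>Jn k. c W * indicator (word_set \<phi> W) x)}" for k
  define T where "T = n ` J"
  have T: "finite T" "\<And>k. k \<in> T \<Longrightarrow> 1 \<le> k \<and> N \<le> k" using J(1) n by (auto simp: T_def)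
  have fin_Jn: "finite (Jn k)" for k using J(1) by (simp add: Jn_def)
  have regroup: "(\<Sum>W\<in>J. h W) = (\<Sum>k\<in>T. \<Sum>W\<in>Jn k. h W)" for h :: "_ \<Rightarrow> real"
    unfolding T_def Jn_def using J(1) by (rule sum.image_gen)
  \<comment> \<open>Pigeonhole: a point below the threshold \<open>t k\<close> at every level would
    have total weight less than 1.\<close>
  have cover_Z: "K \<subseteq> (\<Union>k\<in>T. Z k)"
  proof (rule ccontr)
    assume "\<not> ?thesis"
    then obtain x where x: "x \<in> K" "\<And>k. k \<in> T \<Longrightarrow> x \<notin> Z k" by blast
    have le: "(\<Sum>W\<in>Jn k. c W * indicator (word_set \<phi> W) x) \<le> t k" if "k \<in> T" for k
      using x(2)[OF that] x(1) by (simp add: Z_def)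
    have "1 \<le> (\<Sum>W\<in>J. c W * indicator (word_set \<phi> W) x)" by (rule ge1[OF x(1)])
    also have "\<dots> \<le> (\<Sum>k\<in>T. t k)" unfolding regroup using le by (rule sum_mono)
    also have "\<dots> < 1" unfolding t_def using T by (intro sum_inverse_consecutive_less_1) auto
    finally show False by simp
  qed
  have t_pos: "0 < t k" if "k \<in> T" for k using T(2)[OF that] by (simp add: t_def)
  have "\<exists>E. finite E \<and> Z k \<subseteq> (\<Union>x\<in>E. \<Union>W\<in>{W\<in>Jn k. x \<in> word_set \<phi> W}. word_set \<phi> W) \<and>
      real (card E) * t k \<le> sum c (Jn k)" if "k \<in> T" for k
    by (rule greedy_cover[OF fin_Jn c t_pos[OF that]]) (simp add: Z_def)
  then have "\<exists>E. \<forall>k\<in>T. finite (E k) \<and>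
      Z k \<subseteq> (\<Union>x\<in>E k. \<Union>W\<in>{W\<in>Jn k. x \<in> word_set \<phi> W}. word_set \<phi> W) \<and>
      real (card (E k)) * t k \<le> sum c (Jn k)"
    by (intro bchoice ballI)
  then obtain E where E: "\<forall>k\<in>T. finite (E k) \<and>
      Z k \<subseteq> (\<Union>x\<in>E k. \<Union>W\<in>{W\<in>Jn k. x \<in> word_set \<phi> W}. word_set \<phi> W) \<and>
      real (card (E k)) * t k \<le> sum c (Jn k)" ..
  have E_fin: "finite (E k)" if "k \<in> T" for k using E that by simp
  have E_cover: "Z k \<subseteq> (\<Union>x\<in>E k. \<Union>W\<in>{W\<in>Jn k. x \<in> word_set \<phi> W}. word_set \<phi> W)"
    if "k \<in> T" for k using E that by simp
  have E_card: "real (card (E k)) * t k \<le> sum c (Jn k)" if "k \<in> T" for k using E that by simp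
  have "\<exists>v. \<forall>z. v z \<in> \<V> \<and> (\<forall>U\<in>\<U>. z \<in> U \<longrightarrow> U \<subseteq> v z)"
    using star by (intro choice allI) blast
  then obtain v where v: "\<forall>z. v z \<in> \<V> \<and> (\<forall>U\<in>\<U>. z \<in> U \<longrightarrow> U \<subseteq> v z)" ..
  \<comment> \<open>The word of the star: \<open>v (\<phi> g x)\<close> contains every member of
    \<open>\<U>\<close> through \<open>\<phi> g x\<close>.\<close>
  define w where "w = (\<lambda>(k, x) g. if g \<in> F k then Some (v (\<phi> g x)) else None)"
  have w: "w (k, x) \<in> cover_words (F k) \<V>" for k x
    using v by (auto simp: w_def cover_words_def dom_def ran_def split: if_splits)
  have w_cover: "word_set \<phi> W \<subseteq> word_set \<phi> (w (k, x))" if W: "W \<in> Jn k" "x \<in> word_set \<phi> W" for W k x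
  proof
    fix y assume y: "y \<in> word_set \<phi> W"
    have cw: "W \<in> cover_words (F k) \<U>" using W(1) n by (auto simp: Jn_def)
    have "\<phi> g y \<in> v (\<phi> g x)" if g: "g \<in> F k" for g
    proof -
      have "the (W g) \<in> \<U>" "\<phi> g x \<in> the (W g)" "\<phi> g y \<in> the (W g)"
        using cover_words_the[OF cw g] cw g W(2) y by (auto simp: cover_words_def word_set_def)
      then show ?thesis using v by blast
    qed
    then show "y \<in> word_set \<phi> (w (k, x))" by (auto simp: word_set_def w_def dom_def)
  qed
  define P where "P = Sigma T E"
  have P: "finite P" using T(1) E_fin by (auto simp: P_def)
  have sub: "w ` P \<subseteq> (\<Union>j\<in>{j. j \<ge> 1 \<and> j \<ge> N}. cover_words (F j) \<V>)"
  proof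
    fix W assume "W \<in> w ` P"
    then obtain k x where "k \<in> T" "W = w (k, x)" by (auto simp: P_def)
    then show "W \<in> (\<Union>j\<in>{j. j \<ge> 1 \<and> j \<ge> N}. cover_words (F j) \<V>)"
      using T(2)[of k] w[of k x] by auto
  qed
  have cov: "K \<subseteq> (\<Union>W\<in>w ` P. word_set \<phi> W)"
  proof
    fix y assume "y \<in> K"
    then obtain k where k: "k \<in> T" "y \<in> Z k" using cover_Z by auto
    then obtain x W where "x \<in> E k" "W \<in> Jn k" "x \<in> word_set \<phi> W" "y \<in> word_set \<phi> W"
      using E_cover[of k] by blast
    then show "y \<in> (\<Union>W\<in>w ` P. word_set \<phi> W)" using w_cover[of W k x] k(1) by (auto simp: P_def)
  qed
  have "cover_sum_from \<phi> F K \<V> N (s + \<delta>)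
      \<le> (\<Sum>\<^sub>\<infinity>W\<in>w ` P. ennreal (exp (- (s + \<delta>) * real (word_length W))))"
    unfolding cover_sum_from_def using sub cov by (intro INF_lower) auto
  also have "\<dots> = ennreal (\<Sum>W\<in>w ` P. exp (- (s + \<delta>) * real (word_length W)))"
    using P by (simp add: sum_ennreal)
  also have "\<dots> \<le> ennreal (\<Sum>W\<in>J. c W * exp (- s * real (word_length W)))"
  proof (rule ennreal_leI)
    \<comment> \<open>Different pairs may give the same word, so the sum over the image is only
      bounded by the sum over pairs.\<close>
    have "(\<Sum>W\<in>w ` P. exp (- (s + \<delta>) * real (word_length W)))
        \<le> (\<Sum>p\<in>P. exp (- (s + \<delta>) * real (word_length (w p))))"
      using sum_image_le[OF P, of "\<lambda>W. exp (- (s + \<delta>) * real (word_length W))" w] by (simp add: o_def)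
    also have "\<dots> = (\<Sum>(k, x)\<in>P. exp (- (s + \<delta>) * real (card (F k))))"
      by (intro sum.cong) (auto simp: word_length_cover_words[OF w])
    also have "\<dots> = (\<Sum>k\<in>T. real (card (E k)) * exp (- (s + \<delta>) * real (card (F k))))"
      unfolding P_def using T(1) E_fin by (subst sum.Sigma[symmetric]) auto
    also have "\<dots> \<le> (\<Sum>k\<in>T. \<Sum>W\<in>Jn k. c W * exp (- s * real (word_length W)))"
    proof (rule sum_mono)
      fix k assume k: "k \<in> T"
      have k1: "1 \<le> k" "N \<le> k" using T(2)[OF k] by auto
      \<comment> \<open>The surplus \<open>\<delta>\<close> in the exponent supplies the factor
        \<open>t k\<close>, which \<open>E_card\<close> converts from the number of chosen points
        into the weight of the level.\<close>
      have "exp (- \<delta> * real (card (F k))) \<le> exp (- ln (real k * real (k + 1)))"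
        using growth[OF k1] by simp
      also have "\<dots> = t k" using k1 by (simp add: t_def exp_minus inverse_eq_divide)
      finally have "exp (- \<delta> * real (card (F k))) \<le> t k" .
      moreover have split: "exp (- (s + \<delta>) * real (card (F k)))
          = exp (- \<delta> * real (card (F k))) * exp (- s * real (card (F k)))"
        by (simp flip: exp_add add: algebra_simps)
      ultimately have "real (card (E k)) * exp (- (s + \<delta>) * real (card (F k)))
          \<le> real (card (E k)) * (t k * exp (- s * real (card (F k))))"
        unfolding split by (intro mult_left_mono mult_right_mono) auto
      also have "\<dots> \<le> sum c (Jn k) * exp (- s * real (card (F k)))"
        unfolding mult.assoc[symmetric] using E_card[OF k] by (rule mult_right_mono) simp
      also have "\<dots> = (\<Sum>W\<in>Jn k. c W * exp (- s * real (word_length W)))"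
      proof -
        have "word_length W = card (F k)" if "W \<in> Jn k" for W
          using that n by (intro word_length_cover_words) (auto simp: Jn_def)
        then show ?thesis by (simp add: sum_distrib_right)
      qed
      finally show "real (card (E k)) * exp (- (s + \<delta>) * real (card (F k)))
          \<le> (\<Sum>W\<in>Jn k. c W * exp (- s * real (word_length W)))" .
    qed
    also have "\<dots> = (\<Sum>W\<in>J. c W * exp (- s * real (word_length W)))" by (rule regroup[symmetric])
    finally show "(\<Sum>W\<in>w ` P. exp (- (s + \<delta>) * real (word_length W)))
      \<le> (\<Sum>W\<in>J. c W * exp (- s * real (word_length W)))" .
  qed
  finally show ?thesis .
qed

section \<open>Local entropy and Bowen entropy\<close>

text \<open>Levels start at 1, as in the cover sums; the set \<open>F 0\<close> does not affect a
  lower limit.\<close>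

locale finite_continuous_families =
  fixes \<phi> :: "'g \<Rightarrow> 'x::metric_space \<Rightarrow> 'x" and F :: "nat \<Rightarrow> 'g set"
  assumes finite_F: "1 \<le> n \<Longrightarrow> finite (F n)"
    and continuous_F: "1 \<le> n \<Longrightarrow> g \<in> F n \<Longrightarrow> continuous_on UNIV (\<phi> g)"
begin

lemma open_bowen_ball:
  assumes "1 \<le> n"
  shows "open (bowen_ball \<phi> (F n) x r)"
proof -
  have "bowen_ball \<phi> (F n) x r = (\<Inter>g\<in>F n. {y. dist (\<phi> g x) (\<phi> g y) < r})"
    by (auto simp: bowen_ball_def)
  moreover have "open {y. dist (\<phi> g x) (\<phi> g y) < r}" if "g \<in> F n" for g
    using continuous_F[OF assms that] by (intro open_Collect_less continuous_intros)
  ultimately show ?thesis using finite_F[OF assms] by auto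
qed

lemma open_word_set:
  assumes n: "1 \<le> n" and \<U>: "finite_open_cover \<U>" and W: "W \<in> cover_words (F n) \<U>"
  shows "open (word_set \<phi> W)"
proof -
  have "word_set \<phi> W = (\<Inter>g\<in>F n. \<phi> g -` the (W g))"
    using W by (auto simp: word_set_def cover_words_def)
  moreover have "open (\<phi> g -` the (W g))" if "g \<in> F n" for g
    using continuous_F[OF n that] cover_words_the[OF W that] \<U>
    by (intro open_vimage) (auto simp: finite_open_cover_def)
  ultimately show ?thesis using finite_F[OF n] by auto
qed

lemma lower_local_entropy_at_scale_antimono:
  assumes \<mu>: "\<mu> \<in> borel_prob_measures" and le: "\<epsilon> \<le> \<epsilon>'"
  shows "lower_local_entropy_at_scale \<phi> F \<mu> x \<epsilon>' \<le> lower_local_entropy_at_scale \<phi> F \<mu> x \<epsilon>"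
proof -
  interpret prob_space \<mu> using \<mu> by (simp add: borel_prob_measures_def)
  have "measure \<mu> (bowen_ball \<phi> (F n) x \<epsilon>) \<le> measure \<mu> (bowen_ball \<phi> (F n) x \<epsilon>')" if "1 \<le> n" for n
    using open_bowen_ball[OF that] \<mu>
    by (intro finite_measure_mono bowen_ball_mono[OF le]) (simp add: borel_prob_measures_def)
  then have "ereal (1 / real (card (F n))) * neg_log (measure \<mu> (bowen_ball \<phi> (F n) x \<epsilon>'))
      \<le> ereal (1 / real (card (F n))) * neg_log (measure \<mu> (bowen_ball \<phi> (F n) x \<epsilon>))" if "1 \<le> n" for n
    using that by (intro ereal_mult_left_mono neg_log_antimono) auto
  then show ?thesis
    unfolding lower_local_entropy_at_scale_def
    by (intro Liminf_mono eventually_sequentiallyI[of 1])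
qed

text \<open>Monotonicity in the scale turns the limit into a supremum, so a lower bound at one scale
  suffices.\<close>

lemma lower_local_entropy_at_eq_SUP:
  assumes \<mu>: "\<mu> \<in> borel_prob_measures"
  shows "lower_local_entropy_at \<phi> F \<mu> x
    = (SUP \<epsilon>\<in>{0<..}. lower_local_entropy_at_scale \<phi> F \<mu> x \<epsilon>)" (is "_ = ?S")
  unfolding lower_local_entropy_at_def
proof (rule tendsto_Lim)
  show "((\<lambda>\<epsilon>. lower_local_entropy_at_scale \<phi> F \<mu> x \<epsilon>) \<longlongrightarrow> ?S) (at_right 0)"
  proof (rule increasing_tendsto)
    show "\<forall>\<^sub>F \<epsilon> in at_right 0. lower_local_entropy_at_scale \<phi> F \<mu> x \<epsilon> \<le> ?S"
      by (auto simp: eventually_at_right_field intro!: exI[of _ 1] SUP_upper)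
    fix y assume "y < ?S"
    then obtain e where e: "0 < e" "y < lower_local_entropy_at_scale \<phi> F \<mu> x e"
      by (auto simp: less_SUP_iff)
    have "y < lower_local_entropy_at_scale \<phi> F \<mu> x \<epsilon>" if "\<epsilon> < e" for \<epsilon>
      using e(2) lower_local_entropy_at_scale_antimono[OF \<mu> less_imp_le[OF that]]
      by (rule less_le_trans)
    then show "\<forall>\<^sub>F \<epsilon> in at_right 0. y < lower_local_entropy_at_scale \<phi> F \<mu> x \<epsilon>"
      using e(1) unfolding eventually_at_right_field by blast
  qed
qed simp

text \<open>Stated for one \<open>N\<close> and one \<open>r\<close>: later only the scales
  \<open>1 / real (Suc k)\<close> are used, so countably many null sets are combined.\<close>

lemma AE_bowen_ball_measure_gt:
  assumes compact: "compact (UNIV :: 'x set)" and K: "compact K"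
    and \<mu>: "\<mu> \<in> borel_prob_measures" and s: "bowen_entropy \<phi> F K < ereal s" and r: "0 < r"
  shows "AE x in \<mu>. x \<in> K \<longrightarrow>
    (\<exists>n\<ge>max 1 N. exp (- s * real (card (F n))) < measure \<mu> (bowen_ball \<phi> (F n) x r))"
proof -
  interpret prob_space \<mu> using \<mu> by (simp add: borel_prob_measures_def)
  have sets: "A \<in> sets \<mu>" if "open A" for A
    using \<mu> that by (simp add: borel_prob_measures_def)
  define A where "A = {x\<in>K. \<forall>n\<ge>max 1 N.
      measure \<mu> (bowen_ball \<phi> (F n) x r) \<le> exp (- s * real (card (F n)))}"
  obtain \<U> :: "'x set set" where \<U>: "finite_open_cover \<U>"
    and small: "\<And>U x y. U \<in> \<U> \<Longrightarrow> x \<in> U \<Longrightarrow> y \<in> U \<Longrightarrow> dist x y < r"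
    using finite_small_open_cover[OF compact r] by blast
  have "bowen_entropy_cover \<phi> F K \<U> \<le> bowen_entropy \<phi> F K"
    unfolding bowen_entropy_def using \<U> by (intro SUP_upper) simp
  then have zero: "cover_sum_from \<phi> F K \<U> N s = 0"
    using s by (intro cover_sum_from_eq_0) (rule le_less_trans)
  have "AE x in \<mu>. x \<notin> A"
  proof (rule AE_not_in_of_small_cover)
    fix e :: real assume "0 < e"
    then have "cover_sum_from \<phi> F K \<U> N s < ennreal e" using zero by simp
    then obtain \<Lambda> where \<Lambda>: "\<Lambda> \<subseteq> (\<Union>j\<in>{j. j \<ge> 1 \<and> j \<ge> N}. cover_words (F j) \<U>)"
      "K \<subseteq> (\<Union>W\<in>\<Lambda>. word_set \<phi> W)"
      and sum: "(\<Sum>\<^sub>\<infinity>W\<in>\<Lambda>. ennreal (exp (- s * real (word_length W)))) < ennreal e"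
      unfolding cover_sum_from_def INF_less_iff by blast
    have op: "open (word_set \<phi> W)" if "W \<in> \<Lambda>" for W
      using \<Lambda>(1) that open_word_set[OF _ \<U>] by blast
    \<comment> \<open>Words are open and \<open>K\<close> is compact, so finite subadditivity of the
      measure is enough.\<close>
    obtain \<Lambda>0 where \<Lambda>0: "\<Lambda>0 \<subseteq> \<Lambda>" "finite \<Lambda>0" "K \<subseteq> (\<Union>W\<in>\<Lambda>0. word_set \<phi> W)"
      using compactE_image[OF K op \<Lambda>(2)] by metis
    \<comment> \<open>A word is controlled through a point of \<open>A\<close> inside it: it lies in
      the Bowen ball around that point. Words missing \<open>A\<close> are dropped.\<close>
    define \<Lambda>A where "\<Lambda>A = {W\<in>\<Lambda>0. word_set \<phi> W \<inter> A \<noteq> {}}"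
    have \<Lambda>A: "finite \<Lambda>A" "\<Lambda>A \<subseteq> \<Lambda>" using \<Lambda>0 by (auto simp: \<Lambda>A_def)
    have "emeasure \<mu> (word_set \<phi> W) \<le> ennreal (exp (- s * real (word_length W)))"
      if W: "W \<in> \<Lambda>A" for W
    proof -
      obtain x where x: "x \<in> word_set \<phi> W" "x \<in> A" using W by (auto simp: \<Lambda>A_def)
      obtain j where j: "1 \<le> j" "N \<le> j" "W \<in> cover_words (F j) \<U>" using W \<Lambda>A(2) \<Lambda>(1) by auto
      have "measure \<mu> (word_set \<phi> W) \<le> measure \<mu> (bowen_ball \<phi> (F j) x r)"
        using word_set_subset_bowen_ball[OF j(3) x(1) small] sets[OF open_bowen_ball[OF j(1)]]
        by (intro finite_measure_mono) auto
      also have "\<dots> \<le> exp (- s * real (card (F j)))" using x(2) j by (auto simp: A_def)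
      finally show ?thesis
        by (simp add: emeasure_eq_measure word_length_cover_words[OF j(3)] ennreal_leI)
    qed
    then have "emeasure \<mu> (\<Union>W\<in>\<Lambda>A. word_set \<phi> W) \<le> (\<Sum>W\<in>\<Lambda>A. ennreal (exp (- s * real (word_length W))))"
      using \<Lambda>A op sets
      by (intro order_trans[OF emeasure_subadditive_finite] sum_mono) auto
    also have "\<dots> = (\<Sum>\<^sub>\<infinity>W\<in>\<Lambda>A. ennreal (exp (- s * real (word_length W))))" using \<Lambda>A(1) by simp
    also have "\<dots> \<le> (\<Sum>\<^sub>\<infinity>W\<in>\<Lambda>. ennreal (exp (- s * real (word_length W))))"
      using \<Lambda>A(2) by (intro infsum_mono_neutral nonneg_summable_on_complete) auto
    also note sum
    finally have "emeasure \<mu> (\<Union>W\<in>\<Lambda>A. word_set \<phi> W) \<le> ennreal e" by simp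
    moreover have "A \<subseteq> (\<Union>W\<in>\<Lambda>A. word_set \<phi> W)"
    proof
      fix x assume x: "x \<in> A"
      then have "x \<in> K" by (simp add: A_def)
      then obtain W where "W \<in> \<Lambda>0" "x \<in> word_set \<phi> W" using \<Lambda>0(3) by auto
      then show "x \<in> (\<Union>W\<in>\<Lambda>A. word_set \<phi> W)" using x by (auto simp: \<Lambda>A_def)
    qed
    moreover have "(\<Union>W\<in>\<Lambda>A. word_set \<phi> W) \<in> sets \<mu>" using \<Lambda>A(2) op by (intro sets open_UN) auto
    ultimately show "\<exists>U\<in>sets \<mu>. A \<subseteq> U \<and> emeasure \<mu> U \<le> ennreal e" by blast
  qed
  then show ?thesis by eventually_elim (auto simp: A_def not_le)
qed

end

section \<open>Pointwise estimates under superlogarithmic growth\<close>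

locale superlogarithmic_families = finite_continuous_families \<phi> F
  for \<phi> :: "'g \<Rightarrow> 'x::metric_space \<Rightarrow> 'x" and F +
  assumes compact_space: "compact (UNIV :: 'x set)"
    and superlogarithmic: "filterlim (\<lambda>n. real (card (F n)) / ln (real n)) at_top sequentially"
begin

lemma eventually_ln_le_card: "\<forall>\<^sub>F n in sequentially. c * ln (real n) \<le> real (card (F n))"
  using filterlim_at_top[THEN iffD1, OF superlogarithmic, rule_format, of c]
    eventually_ge_at_top[of 2]
  by eventually_elim (simp add: field_simps)

lemma card_at_top: "filterlim (\<lambda>n. real (card (F n))) at_top sequentially"
proof (rule filterlim_at_top_mono)
  show "filterlim (\<lambda>n. ln (real n)) at_top sequentially"
    by (rule filterlim_compose[OF ln_at_top filterlim_real_sequentially])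
  show "\<forall>\<^sub>F n in sequentially. ln (real n) \<le> real (card (F n))"
    using eventually_ln_le_card[of 1] by simp
qed

text \<open>For empty \<open>F n\<close> the factor \<open>1 / real (card (F n))\<close> takes the
  default value 0; such \<open>n\<close> must be discarded before multiplying out.\<close>

lemma eventually_card_pos: "\<forall>\<^sub>F n in sequentially. 0 < real (card (F n))"
  using filterlim_at_top_dense[THEN iffD1, OF card_at_top] by blast

text \<open>Arbitrarily late large balls bound the lower limit at each scale
  \<open>1 / real (Suc k)\<close>, and these scales are cofinal at 0.\<close>

lemma lower_local_entropy_at_le:
  assumes \<mu>: "\<mu> \<in> borel_prob_measures"
    and gt: "\<And>N k. \<exists>n\<ge>max 1 N.
      exp (- s * real (card (F n))) < measure \<mu> (bowen_ball \<phi> (F n) x (1 / real (Suc k)))"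
  shows "lower_local_entropy_at \<phi> F \<mu> x \<le> ereal s"
  unfolding lower_local_entropy_at_eq_SUP[OF \<mu>]
proof (rule SUP_least)
  fix e :: real assume "e \<in> {0<..}"
  then obtain k where k: "1 / real (Suc k) < e" using nat_approx_posE by auto
  have "lower_local_entropy_at_scale \<phi> F \<mu> x e
      \<le> lower_local_entropy_at_scale \<phi> F \<mu> x (1 / real (Suc k))"
    using k by (intro lower_local_entropy_at_scale_antimono[OF \<mu>]) simp
  also have "\<dots> \<le> ereal s"
  proof (rule ccontr)
    assume "\<not> ?thesis"
    then have "\<forall>\<^sub>F n in sequentially. ereal s < ereal (1 / real (card (F n))) *
        neg_log (measure \<mu> (bowen_ball \<phi> (F n) x (1 / real (Suc k))))"
      unfolding lower_local_entropy_at_scale_def by (intro less_LiminfD) simp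
    with eventually_card_pos have "\<forall>\<^sub>F n in sequentially. 0 < real (card (F n)) \<and>
        ereal s < ereal (1 / real (card (F n))) *
        neg_log (measure \<mu> (bowen_ball \<phi> (F n) x (1 / real (Suc k))))"
      by (rule eventually_conj)
    then obtain N where N: "\<And>n. N \<le> n \<Longrightarrow> 0 < real (card (F n)) \<and>
        ereal s < ereal (1 / real (card (F n))) *
        neg_log (measure \<mu> (bowen_ball \<phi> (F n) x (1 / real (Suc k))))"
      unfolding eventually_sequentially by blast
    obtain n where n: "max 1 N \<le> n"
      "exp (- s * real (card (F n))) < measure \<mu> (bowen_ball \<phi> (F n) x (1 / real (Suc k)))"
      using gt by blast
    define p where "p = measure \<mu> (bowen_ball \<phi> (F n) x (1 / real (Suc k)))"
    have p: "exp (- s * real (card (F n))) < p" using n(2) by (simp add: p_def)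
    then have p0: "0 < p" by (rule less_trans[OF exp_gt_zero])
    have "- s * real (card (F n)) < ln p" using p p0 by (simp add: ln_less_cancel_iff[symmetric])
    moreover have "0 < real (card (F n)) \<and> ereal s < ereal (1 / real (card (F n))) * neg_log p"
      using n(1) unfolding p_def by (intro N) simp
    then have "0 < real (card (F n))" "s < (1 / real (card (F n))) * (- ln p)"
      using p0 by (auto simp: neg_log_def)
    ultimately show False by (simp add: field_simps)
  qed
  finally show "lower_local_entropy_at_scale \<phi> F \<mu> x e \<le> ereal s" .
qed

text \<open>The constant \<open>c\<close> contributes only \<open>ln c / real (card (F n))\<close>,
  which tends to 0.\<close>

lemma le_lower_local_entropy_at:
  assumes \<mu>: "\<mu> \<in> borel_prob_measures" and r: "0 < r" and c: "0 < c"
    and le: "\<And>n. N \<le> n \<Longrightarrow>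
      measure \<mu> (bowen_ball \<phi> (F n) x r) \<le> exp (- s * real (card (F n))) / c"
  shows "ereal s \<le> lower_local_entropy_at \<phi> F \<mu> x"
proof -
  have "(\<lambda>n. s + ln c / real (card (F n))) \<longlonglongrightarrow> s + 0"
    by (intro tendsto_intros real_tendsto_divide_at_top[OF tendsto_const card_at_top])
  then have "(\<lambda>n. ereal (s + ln c / real (card (F n)))) \<longlonglongrightarrow> ereal s" by simp
  then have "ereal s = liminf (\<lambda>n. ereal (s + ln c / real (card (F n))))"
    by (intro lim_imp_Liminf[symmetric]) simp_all
  also have "\<dots> \<le> lower_local_entropy_at_scale \<phi> F \<mu> x r"
    unfolding lower_local_entropy_at_scale_def
  proof (rule Liminf_mono)
    show "\<forall>\<^sub>F n in sequentially. ereal (s + ln c / real (card (F n)))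
      \<le> ereal (1 / real (card (F n))) * neg_log (measure \<mu> (bowen_ball \<phi> (F n) x r))"
      using eventually_card_pos eventually_ge_at_top[of N]
    proof eventually_elim
      fix n assume n: "0 < real (card (F n))" "N \<le> n"
      have ln: "- ln (exp (- s * real (card (F n))) / c) = s * real (card (F n)) + ln c"
        using c by (simp add: ln_div)
      have "ereal (s + ln c / real (card (F n)))
          = ereal (1 / real (card (F n))) * ereal (- ln (exp (- s * real (card (F n))) / c))"
        unfolding ln using n(1) by (simp add: field_simps)
      also have "\<dots> \<le> ereal (1 / real (card (F n))) * neg_log (measure \<mu> (bowen_ball \<phi> (F n) x r))"
        using le[OF n(2)] c by (intro ereal_mult_left_mono le_neg_log) auto
      finally show "ereal (s + ln c / real (card (F n)))
        \<le> ereal (1 / real (card (F n))) * neg_log (measure \<mu> (bowen_ball \<phi> (F n) x r))" .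
    qed
  qed
  also have "\<dots> \<le> lower_local_entropy_at \<phi> F \<mu> x"
    unfolding lower_local_entropy_at_eq_SUP[OF \<mu>] using r by (intro SUP_upper) simp
  finally show ?thesis .
qed

section \<open>The two inequalities of the variational principle\<close>

lemma lower_local_entropy_le_bowen_entropy:
  assumes K: "compact K" "K \<noteq> {}" and \<mu>: "\<mu> \<in> borel_prob_measures" "measure \<mu> K = 1"
  shows "lower_local_entropy \<phi> F \<mu> \<le> bowen_entropy \<phi> F K"
proof (rule dense_ge)
  fix y assume y: "bowen_entropy \<phi> F K < y"
  interpret prob_space \<mu> using \<mu> by (simp add: borel_prob_measures_def)
  show "lower_local_entropy \<phi> F \<mu> \<le> y"
  proof (cases y)
    case (real s)
    have s: "bowen_entropy \<phi> F K < ereal s" using y real by simp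
    \<comment> \<open>The integral is formed in \<open>ennreal\<close>, where a bound by
      \<open>s\<close> survives the conversion back only for \<open>s \<ge> 0\<close>.\<close>
    have "0 < ereal s" using bowen_entropy_nonneg[OF K(2)] s by (rule le_less_trans)
    then have "0 \<le> s" by simp
    have "AE x in \<mu>. \<forall>N k. x \<in> K \<longrightarrow> (\<exists>n\<ge>max 1 N.
        exp (- s * real (card (F n))) < measure \<mu> (bowen_ball \<phi> (F n) x (1 / real (Suc k))))"
      unfolding AE_all_countable
      using AE_bowen_ball_measure_gt[OF compact_space K(1) \<mu>(1) s] by simp
    moreover have "AE x in \<mu>. x \<in> K" using \<mu>(2) by (rule AE_prob_1)
    ultimately have "AE x in \<mu>. e2ennreal (lower_local_entropy_at \<phi> F \<mu> x) \<le> ennreal s"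
    proof eventually_elim
      case (elim x)
      then have "lower_local_entropy_at \<phi> F \<mu> x \<le> ereal s"
        by (intro lower_local_entropy_at_le[OF \<mu>(1)]) blast
      then show ?case using e2ennreal_mono[of _ "ereal s"] by simp
    qed
    then have "(\<integral>\<^sup>+ x. e2ennreal (lower_local_entropy_at \<phi> F \<mu> x) \<partial>\<mu>) \<le> (\<integral>\<^sup>+ x. ennreal s \<partial>\<mu>)"
      by (rule nn_integral_mono_AE)
    also have "\<dots> = ennreal s" by (simp add: emeasure_space_1)
    finally show ?thesis
      using \<open>0 \<le> s\<close> unfolding lower_local_entropy_def less_eq_ennreal.rep_eq
      by (simp add: real)
  qed (use y in auto)
qed

lemma exists_measure_lower_local_entropy_ge:
  assumes K: "compact K" and s: "ereal s < bowen_entropy \<phi> F K"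
  obtains \<mu> where "\<mu> \<in> borel_prob_measures" "measure \<mu> K = 1" "ereal s \<le> lower_local_entropy \<phi> F \<mu>"
proof -
  obtain \<V> where \<V>: "finite_open_cover \<V>" "ereal s < bowen_entropy_cover \<phi> F K \<V>"
    using s unfolding bowen_entropy_def less_SUP_iff by auto
  \<comment> \<open>The gap between \<open>s\<close> and \<open>s'\<close> pays for replacing
    weighted covers by unweighted ones.\<close>
  obtain s' where s': "ereal s < ereal s'" "ereal s' < bowen_entropy_cover \<phi> F K \<V>"
    using ereal_dense2[OF \<V>(2)] by blast
  define \<delta> where "\<delta> = s' - s"
  have \<delta>: "0 < \<delta>" "s + \<delta> = s'" using s'(1) by (auto simp: \<delta>_def)
  obtain N0 where N0: "cover_sum_from \<phi> F K \<V> N0 s' \<noteq> 0"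
    using cover_sum_from_nonzero[OF s'(2)] by blast
  \<comment> \<open>The factor 3 comes from \<open>n * (n + 1) \<le> n ^ 3\<close> for
    \<open>n \<ge> 2\<close>.\<close>
  have "\<forall>\<^sub>F n in sequentially. 2 \<le> n \<and> 3 / \<delta> * ln (real n) \<le> real (card (F n))"
    using eventually_ge_at_top eventually_ln_le_card by (rule eventually_conj)
  then obtain N1 where N1: "\<And>n. N1 \<le> n \<Longrightarrow> 2 \<le> n \<and> 3 / \<delta> * ln (real n) \<le> real (card (F n))"
    unfolding eventually_sequentially by blast
  have growth: "ln (real n * real (n + 1)) \<le> \<delta> * real (card (F n))" if "N1 \<le> n" for n
  proof -
    have n: "2 \<le> real n" "3 * ln (real n) \<le> \<delta> * real (card (F n))"
      using N1[OF that] \<delta>(1) by (auto simp: field_simps)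
    have "real (n + 1) \<le> real n * 2" using n(1) by simp
    also have "\<dots> \<le> real n * real n" using n(1) by (intro mult_left_mono) auto
    finally have "real n * real (n + 1) \<le> real n * (real n * real n)" by (intro mult_left_mono) auto
    also have "\<dots> = real n ^ 3" by (simp add: power3_eq_cube)
    finally have "ln (real n * real (n + 1)) \<le> ln (real n ^ 3)"
      using n(1) by (intro ln_mono) auto
    also have "\<dots> = 3 * ln (real n)" using n(1) by (simp add: ln_realpow)
    finally show ?thesis using n(2) by simp
  qed
  define N where "N = max 1 (max N0 N1)"
  have "cover_sum_from \<phi> F K \<V> N0 s' \<le> cover_sum_from \<phi> F K \<V> N s'"
    by (rule monoD[OF mono_cover_sum_from]) (simp add: N_def)
  then have M: "cover_sum_from \<phi> F K \<V> N s' \<noteq> 0" using N0 by auto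
  \<comment> \<open>The minimum with 1 makes \<open>c\<close> a positive real number without
    discussing finiteness of the cover sum.\<close>
  define c where "c = enn2real (min 1 (cover_sum_from \<phi> F K \<V> N s'))"
  have min_fin: "min 1 (cover_sum_from \<phi> F K \<V> N s') < \<infinity>" by (simp add: min_less_iff_disj)
  have c_le: "ennreal c \<le> cover_sum_from \<phi> F K \<V> N s'"
    using min_fin by (simp add: c_def)
  have c: "0 < c" unfolding c_def using M min_fin by (auto simp: enn2real_positive_iff min_def zero_less_iff_neq_zero)
  obtain r where r: "0 < r" "\<And>x. \<exists>V\<in>\<V>. ball x r \<subseteq> V"
    using Lebesgue_number_finite_open_cover[OF compact_space \<V>(1)] by auto
  obtain \<U> :: "'x set set" where \<U>: "finite_open_cover \<U>"
    and small: "\<And>U x y. U \<in> \<U> \<Longrightarrow> x \<in> U \<Longrightarrow> y \<in> U \<Longrightarrow> dist x y < r"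
    using finite_small_open_cover[OF compact_space r(1)] by blast
  \<comment> \<open>Members of \<open>\<U>\<close> have diameter below the Lebesgue number
    \<open>r\<close> of \<open>\<V>\<close>, so all those through \<open>z\<close> lie in
    \<open>ball z r\<close>.\<close>
  have star: "\<exists>V\<in>\<V>. \<forall>U\<in>\<U>. z \<in> U \<longrightarrow> U \<subseteq> V" for z
  proof -
    obtain V where "V \<in> \<V>" "ball z r \<subseteq> V" using r(2) by blast
    moreover have "U \<subseteq> ball z r" if "U \<in> \<U>" "z \<in> U" for U
      using small[OF that] by auto
    ultimately show ?thesis by blast
  qed
  define I where "I = (\<Union>j\<in>{j. j \<ge> 1 \<and> j \<ge> N}. cover_words (F j) \<U>)"
  \<comment> \<open>Division by \<open>c\<close> normalizes the lower bound \<open>c\<close> for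
    weighted covers to the bound 1 required for the charge.\<close>
  define a where "a W = exp (- s * real (word_length W)) / c" for W :: "'g \<rightharpoonup> 'x set"
  have cost: "1 \<le> (\<Sum>W\<in>J. b W * a W)"
    if "finite J" "J \<subseteq> I" "\<And>W. 0 \<le> b W"
      "\<And>x. x \<in> K \<Longrightarrow> 1 \<le> (\<Sum>W\<in>J. b W * indicator (word_set \<phi> W) x)" for J b
  proof -
    have "ennreal c \<le> cover_sum_from \<phi> F K \<V> N (s + \<delta>)" using c_le by (simp add: \<delta>(2))
    also have "\<dots> \<le> ennreal (\<Sum>W\<in>J. b W * exp (- s * real (word_length W)))"
      using that growth
      by (intro cover_sum_from_le_weighted[OF star]) (auto simp: I_def N_def)
    finally have "c \<le> (\<Sum>W\<in>J. b W * exp (- s * real (word_length W)))"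
      using that(3) by (subst (asm) ennreal_le_iff) (auto intro!: sum_nonneg)
    also have "\<dots> = c * (\<Sum>W\<in>J. b W * a W)"
      using c by (simp add: a_def sum_distrib_left)
    finally show ?thesis using c by simp
  qed
  have "1 \<le> N" by (simp add: N_def)
  have fin: "finite (cover_words (F N) \<U>)"
    using \<U> finite_F[OF \<open>1 \<le> N\<close>] by (intro finite_cover_words) (auto simp: finite_open_cover_def)
  have sub: "cover_words (F N) \<U> \<subseteq> I" using \<open>1 \<le> N\<close> by (auto simp: I_def)
  have cov: "K \<subseteq> (\<Union>W\<in>cover_words (F N) \<U>. word_set \<phi> W)"
    using cover_word_through[OF \<U>] by blast
  have a: "0 \<le> a W" for W using c by (simp add: a_def)
  have "\<exists>m :: 'x set \<Rightarrow> real. (\<forall>A. 0 \<le> m A) \<and> m UNIV = 1 \<and>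
      (\<forall>A B. A \<inter> B = {} \<longrightarrow> m (A \<union> B) = m A + m B) \<and> m (- K) = 0 \<and>
      (\<forall>W\<in>I. m (word_set \<phi> W) \<le> a W)"
    by (rule finitely_additive_charge_exists[OF _ a fin sub cov]) (fact cost)
  then obtain m :: "'x set \<Rightarrow> real" where m: "(\<forall>A. 0 \<le> m A) \<and> m UNIV = 1 \<and>
      (\<forall>A B. A \<inter> B = {} \<longrightarrow> m (A \<union> B) = m A + m B) \<and> m (- K) = 0 \<and>
      (\<forall>W\<in>I. m (word_set \<phi> W) \<le> a W)" ..
  have m_add: "m (A \<union> B) = m A + m B" if "A \<inter> B = {}" for A B using m that by simp
  have "\<exists>\<mu>\<in>borel_prob_measures. \<forall>U. open U \<longrightarrow> measure \<mu> U \<le> m U"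
    using m by (intro finitely_additive_charge_regularization[OF compact_space _ _ m_add]) auto
  then obtain \<mu> where \<mu>: "\<mu> \<in> borel_prob_measures"
    and le_m: "\<And>U. open U \<Longrightarrow> measure \<mu> U \<le> m U" by auto
  interpret prob_space \<mu> using \<mu> by (simp add: borel_prob_measures_def)
  have sets: "sets \<mu> = sets borel" using \<mu> by (simp add: borel_prob_measures_def)
  have space: "space \<mu> = UNIV" using sets_eq_imp_space_eq[OF sets] by simp
  have K_closed: "closed K" using K by (rule compact_imp_closed)
  \<comment> \<open>The complement of \<open>K\<close> is open, so the bound by \<open>m\<close>
    applies to it and \<open>\<mu>\<close> is carried by \<open>K\<close>.\<close>
  have "measure \<mu> (- K) \<le> 0" using le_m[of "- K"] K_closed m by auto
  then have "measure \<mu> (space \<mu> - K) = 0" by (simp add: space Compl_eq_Diff_UNIV antisym)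
  then have "measure \<mu> K = 1" using prob_compl[of K] K_closed by (simp add: sets)
  \<comment> \<open>A second Lebesgue number, now for \<open>\<U>\<close>: the mass bounds concern
    words of \<open>\<U>\<close>.\<close>
  obtain r' where r': "0 < r'" "\<And>x. \<exists>U\<in>\<U>. ball x r' \<subseteq> U"
    using Lebesgue_number_finite_open_cover[OF compact_space \<U>] by auto
  have "measure \<mu> (bowen_ball \<phi> (F n) x r') \<le> exp (- s * real (card (F n))) / c"
    if n: "N \<le> n" for n x
  proof -
    have n1: "1 \<le> n" using n by (simp add: N_def)
    obtain W where W: "W \<in> cover_words (F n) \<U>" "bowen_ball \<phi> (F n) x r' \<subseteq> word_set \<phi> W"
      using bowen_ball_subset_word_set[OF r'(2)] by blast
    have op: "open (word_set \<phi> W)" by (rule open_word_set[OF n1 \<U> W(1)])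
    have "measure \<mu> (bowen_ball \<phi> (F n) x r') \<le> measure \<mu> (word_set \<phi> W)"
      using W(2) op by (intro finite_measure_mono) (auto simp: sets)
    also have "\<dots> \<le> m (word_set \<phi> W)" by (rule le_m[OF op])
    also have "\<dots> \<le> a W" using m W(1) n n1 by (auto simp: I_def)
    finally show ?thesis by (simp add: a_def word_length_cover_words[OF W(1)])
  qed
  then have ge: "ereal s \<le> lower_local_entropy_at \<phi> F \<mu> x" for x
    by (rule le_lower_local_entropy_at[OF \<mu> r'(1) c])
  \<comment> \<open>For negative \<open>s\<close> the value \<open>ennreal s\<close> is 0 and the
    inequality still holds, so the sign of \<open>s\<close> does not matter.\<close>
  have "ereal s \<le> enn2ereal (ennreal s)"
    by (cases "0 \<le> s") (simp_all add: order_trans[OF _ enn2ereal_nonneg])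
  also have "ennreal s = (\<integral>\<^sup>+ x. ennreal s \<partial>\<mu>)" by (simp add: emeasure_space_1)
  also have "enn2ereal \<dots> \<le> lower_local_entropy \<phi> F \<mu>"
    unfolding lower_local_entropy_def less_eq_ennreal.rep_eq[symmetric]
    using e2ennreal_mono[OF ge] by (intro nn_integral_mono) simp
  finally show thesis using that \<mu> \<open>measure \<mu> K = 1\<close> by blast
qed

end

theorem theorem3p1:
  fixes G :: "('g, 'b) monoid_scheme"
    and \<phi> :: "'g \<Rightarrow> 'x::metric_space \<Rightarrow> 'x"
    and F :: "nat \<Rightarrow> 'g set"
    and K :: "'x set"
  assumes "compact (UNIV :: 'x set)"
    and "countable_amenable_group G"
    and "group_action G (UNIV :: 'x set) \<phi>"
    and "\<And>g. g \<in> carrier G \<Longrightarrow> \<exists>\<psi>. homeomorphism UNIV UNIV (\<phi> g) \<psi>"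
    and "K \<noteq> {}" and "compact K"
    and "\<And>n. n \<ge> 1 \<Longrightarrow> finite (F n) \<and> F n \<subseteq> carrier G"
    and "filterlim (\<lambda>n. real (card (F n)) / ln (real n)) at_top sequentially"
  shows "bowen_entropy \<phi> F K =
    (SUP \<mu> \<in> {\<mu> \<in> borel_prob_measures. measure \<mu> K = 1}. lower_local_entropy \<phi> F \<mu>)"
proof -
  interpret superlogarithmic_families \<phi> F
  proof
    show "finite (F n)" if "1 \<le> n" for n using assms(7)[OF that] by simp
    show "continuous_on UNIV (\<phi> g)" if "1 \<le> n" "g \<in> F n" for n g
      using assms(4)[of g] assms(7)[OF that(1)] that(2) by (auto simp: homeomorphism_def)
  qed (fact assms(1,8))+
  show ?thesis
  proof (rule antisym)
    show "bowen_entropy \<phi> F K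
        \<le> (SUP \<mu> \<in> {\<mu> \<in> borel_prob_measures. measure \<mu> K = 1}. lower_local_entropy \<phi> F \<mu>)"
    proof (rule dense_le)
      fix y assume y: "y < bowen_entropy \<phi> F K"
      then obtain s where s: "y < ereal s" "ereal s < bowen_entropy \<phi> F K"
        using ereal_dense2 by blast
      obtain \<mu> where "\<mu> \<in> borel_prob_measures" "measure \<mu> K = 1" "ereal s \<le> lower_local_entropy \<phi> F \<mu>"
        using exists_measure_lower_local_entropy_ge[OF assms(6) s(2)] by blast
      then show "y \<le> (SUP \<mu> \<in> {\<mu> \<in> borel_prob_measures. measure \<mu> K = 1}. lower_local_entropy \<phi> F \<mu>)"
        using s(1) by (intro SUP_upper2[of \<mu>]) auto
    qed
    show "(SUP \<mu> \<in> {\<mu> \<in> borel_prob_measures. measure \<mu> K = 1}. lower_local_entropy \<phi> F \<mu>)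
        \<le> bowen_entropy \<phi> F K"
      using lower_local_entropy_le_bowen_entropy[OF assms(6,5)] by (intro SUP_least) simp
  qed
qed

end
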